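(* Let $q\in L^1[0,1]$ be real-valued, $w_0>0$, $a\in(0,1)$. Suppose that the problem $-y''+qy=\lambda y$, $y(0)=0=y(1)$, is left-definite and that $$0<r<\min\left\{\min_{t\in(0,a]}\frac{1}{\left(R(t)-\frac{R(a)}{L(a)}L(t)\right)L(t)},\ \min_{t\in[a,1)}\frac{1}{\left(L(t)-\frac{L(a)}{R(a)}R(t)\right)R(t)}\right\}.$$ Let $\lambda(t)$ be the first eigenvalue function of $(P_1)$, with $\lambda_1=\lambda(0)=\lambda(1)$. Then $q$ can be uniquely determined by $\lambda(t)$, and $$q(x)=\begin{cases}R''(x)/R(x),& x\in(0,a],\\ L''(x)/L(x),& x\in[a,1),\end{cases}$$ where $L$ and $R$ can be expressed explicitly by $$R(t)=\left\{\frac{r\left[e^{r(a-t)}+r\int_t^a\frac{\lambda(s)}{\lambda_1-\lambda(s)}e^{r(s-t)}\,ds+\frac{\lambda(t)}{\lambda_1-\lambda(t)}\right]}{\left[e^{r(a-t)}+r\int_t^a\frac{\lambda(s)}{\lambda_1-\lambda(s)}e^{r(s-t)}\,ds\right]^2}\right\}^{-1/2},\quad t\in(0,a],$$ $$L(t)=\left\{\frac{r\left[e^{r(t-a)}+r\int_a^t\frac{\lambda(s)}{\lambda_1-\lambda(s)}e^{r(t-s)}\,ds+\frac{\lambda(t)}{\lambda_1-\lambda(t)}\right]}{\left[e^{r(t-a)}+r\int_a^t\frac{\lambda(s)}{\lambda_1-\lambda(s)}e^{r(t-s)}\,ds\right]^2}\right\}^{-1/2},\quad t\in[a,1).$$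
   Context: Left-definiteness of $-y''+qy=\lambda y$, $y(0)=0=y(1)$, means that all its (Dirichlet) eigenvalues are positive. $L$ and $R$ are solutions of $-y''+qy=0$ on $[0,1]$ with $L(0)=0$, $L'(0)>0$, $R(1)=0$, $R'(1)<0$, taken so that $W[L,R]=LR'-L'R\equiv-1$. Under left-definiteness, $L>0$ and $R>0$ on $(0,1)$. In the condition on $r$, the quotients are interpreted as $+\infty$ at $t=a$, where the denominators vanish. Identities for $q$ are understood almost everywhere, $q$ being an element of $L^1[0,1]$. The unperturbed problem is $$(P_1):\quad -y''+q(x)y=\lambda w_0\,\delta(x-a)\,y,\ x\in[0,1],\qquad y(0)=0=y(1),$$ where $\delta(x-a)$ is the Dirac delta function at $a$, and for fixed $r>0$ and $t\in[0,1]$ the perturbed problem is $$(P_1^t):\quad -y''+[q(x)-r\delta(x-t)]y=\lambda w_0\,\delta(x-a)\,y,\ x\in[0,1],\qquad y(0)=0=y(1).$$ Solutions are functions $y$ absolutely continuous on $[0,1]$, with $y'$ absolutely continuous on each open subinterval between consecutive points of $\{0,a,t,1\}$ and with one-sided derivatives at these points, such that $-y''+qy=0$ a.e. away from $a,t$, $y(0)=0=y(1)$, and at each interior point $s\in\{a,t\}$ one has $y'(s^-)-y'(s^+)=\kappa(s)y(s)$, where $\kappa(s)$ is the sum of $\lambda w_0$ (if $s=a$) and $r$ (if $s=t$). For $(P_1)$ the $r$-term is absent. For $t=0$ and $t=1$ the perturbation has no effect, i.e. $(P_1^0)=(P_1^1)=(P_1)$. An eigenvalue is a number $\lambda$ for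 which a nontrivial solution exists; the first eigenvalue is the smallest one. $\lambda_1$ denotes the unique eigenvalue of $(P_1)$. The first eigenvalue function $\lambda(t)$ of $(P_1)$ is the function assigning to $t$ the first eigenvalue of $(P_1^t)$; under the stated hypotheses it exists. The numbers $a$, $w_0$, $r$ are fixed and given.
   Formalization: The conditions on L, R with W[L,R]=-1 leave a free scaling (cL, R/c), c>0, and the explicit formulas fail unless L(a)=R(a); the formal statement allows any such pair in the hypotheses and asserts the formulas for the rescaled pair with L(a)=R(a). *)

theory Defs
  imports "HOL-Analysis.Analysis"
begin

text \<open>The library has no epsilon-delta absolute continuity of functions. \<open>S\<close> is meant to be an
  interval; the pairs in \<open>D\<close> are the endpoints of non-overlapping compact subintervals of \<open>S\<close>.\<close>

definition abs_cont_on :: "real set \<Rightarrow> (real \<Rightarrow> real) \<Rightarrow> bool" where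
  "abs_cont_on S f \<longleftrightarrow>
     (\<forall>\<epsilon>>0. \<exists>\<delta>>0. \<forall>D :: (real \<times> real) set.
        finite D \<and> (\<forall>(u, v)\<in>D. u < v \<and> {u..v} \<subseteq> S) \<and>
        disjoint_family_on (\<lambda>(u, v). {u<..<v}) D \<and>
        (\<Sum>(u, v)\<in>D. v - u) < \<delta>
        \<longrightarrow> (\<Sum>(u, v)\<in>D. \<bar>f v - f u\<bar>) < \<epsilon>)"

text \<open>Solutions on \<open>[0,1]\<close> of \<open>-y'' + (q - \<Sum>s\<in>S. \<kappa>(s) \<delta>(x - s)) y = 0\<close> (no boundary conditions).
  Points of \<open>S\<close> outside the open interval have no effect. For \<open>S = {}\<close> this is the usual notion
  of solution of \<open>-y'' + q y = 0\<close>: absolute continuity of \<open>y'\<close> on \<open>(0,1)\<close> together with the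
  one-sided differentiability of \<open>y\<close> at 0 and 1 is absolute continuity of \<open>y'\<close> on \<open>[0,1]\<close>.
  Only values of \<open>y\<close> on \<open>[0,1]\<close> matter.\<close>

definition delta_solution ::
    "(real \<Rightarrow> real) \<Rightarrow> real set \<Rightarrow> (real \<Rightarrow> real) \<Rightarrow> (real \<Rightarrow> real) \<Rightarrow> bool" where
  "delta_solution q S \<kappa> y \<longleftrightarrow>
     abs_cont_on {0..1} y \<and>
     (\<forall>u\<in>{0, 1} \<union> S. \<forall>v\<in>{0, 1} \<union> S. 0 \<le> u \<and> u < v \<and> v \<le> 1 \<and> {u<..<v} \<inter> S = {} \<longrightarrow>
        (\<forall>x\<in>{u<..<v}. y differentiable (at x)) \<and> abs_cont_on {u<..<v} (deriv y) \<and>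
        y differentiable (at_right u) \<and> y differentiable (at_left v)) \<and>
     (AE x in lebesgue. x \<in> {0<..<1} - S \<longrightarrow>
        (\<exists>y2. (deriv y has_real_derivative y2) (at x) \<and> - y2 + q x * y x = 0)) \<and>
     (\<forall>s\<in>S \<inter> {0<..<1}.
        \<exists>m p. (y has_real_derivative m) (at_left s) \<and> (y has_real_derivative p) (at_right s) \<and>
              m - p = \<kappa> s * y s)"

definition dirichlet_nontrivial :: "(real \<Rightarrow> real) \<Rightarrow> bool" where
  "dirichlet_nontrivial y \<longleftrightarrow> y 0 = 0 \<and> y 1 = 0 \<and> (\<exists>x\<in>{0..1}. y x \<noteq> 0)"

definition regular_eigenvalue :: "(real \<Rightarrow> real) \<Rightarrow> real \<Rightarrow> bool" where
  "regular_eigenvalue q \<mu> \<longleftrightarrow>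
     (\<exists>y. delta_solution (\<lambda>x. q x - \<mu>) {} (\<lambda>_. 0) y \<and> dirichlet_nontrivial y)"

definition left_definite :: "(real \<Rightarrow> real) \<Rightarrow> bool" where
  "left_definite q \<longleftrightarrow> (\<forall>\<mu>. regular_eigenvalue q \<mu> \<longrightarrow> \<mu> > 0)"

definition eigenvalue_P1 :: "(real \<Rightarrow> real) \<Rightarrow> real \<Rightarrow> real \<Rightarrow> real \<Rightarrow> bool" where
  "eigenvalue_P1 q a w0 \<mu> \<longleftrightarrow>
     (\<exists>y. delta_solution q {a} (\<lambda>_. \<mu> * w0) y \<and> dirichlet_nontrivial y)"

definition eigenvalue_P1t ::
    "(real \<Rightarrow> real) \<Rightarrow> real \<Rightarrow> real \<Rightarrow> real \<Rightarrow> real \<Rightarrow> real \<Rightarrow> bool" where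
  "eigenvalue_P1t q a w0 r t \<mu> \<longleftrightarrow>
     (\<exists>y. delta_solution q {a, t}
            (\<lambda>s. (if s = a then \<mu> * w0 else 0) + (if s = t then r else 0)) y \<and>
          dirichlet_nontrivial y)"

definition unperturbed_eigenvalue :: "(real \<Rightarrow> real) \<Rightarrow> real \<Rightarrow> real \<Rightarrow> real" where
  "unperturbed_eigenvalue q a w0 = (THE \<mu>. eigenvalue_P1 q a w0 \<mu>)"

definition first_eigenvalue ::
    "(real \<Rightarrow> real) \<Rightarrow> real \<Rightarrow> real \<Rightarrow> real \<Rightarrow> real \<Rightarrow> real" where
  "first_eigenvalue q a w0 r t = (LEAST \<mu>. eigenvalue_P1t q a w0 r t \<mu>)"

text \<open>The derivative on \<open>[0,1]\<close>, one-sided at the endpoints.\<close>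

abbreviation deriv01 :: "(real \<Rightarrow> real) \<Rightarrow> real \<Rightarrow> real" where
  "deriv01 y x \<equiv> vector_derivative y (at x within {0..1})"

text \<open>The pair \<open>(L, R)\<close> is only determined up to the scaling \<open>(c L, R / c)\<close> with \<open>c > 0\<close>.\<close>

definition fundamental_pair :: "(real \<Rightarrow> real) \<Rightarrow> (real \<Rightarrow> real) \<Rightarrow> (real \<Rightarrow> real) \<Rightarrow> bool" where
  "fundamental_pair q L R \<longleftrightarrow>
     delta_solution q {} (\<lambda>_. 0) L \<and> delta_solution q {} (\<lambda>_. 0) R \<and>
     L 0 = 0 \<and> deriv01 L 0 > 0 \<and> R 1 = 0 \<and> deriv01 R 1 < 0 \<and>
     (\<forall>x\<in>{0..1}. L x * deriv01 R x - deriv01 L x * R x = -1)"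

text \<open>In \<^typ>\<open>ereal\<close> one has \<open>1 / 0 = \<infinity>\<close>, which is the convention needed at \<open>t = a\<close>. The infima
  are minima since the denominators are continuous, positive inside the two intervals and tend
  to 0 at their ends. The bound is invariant under the scaling of \<open>(L, R)\<close>.\<close>

definition r_bound :: "real \<Rightarrow> (real \<Rightarrow> real) \<Rightarrow> (real \<Rightarrow> real) \<Rightarrow> ereal" where
  "r_bound a L R =
     min (INF t\<in>{0<..a}. 1 / ereal ((R t - R a / L a * L t) * L t))
         (INF t\<in>{a..<1}. 1 / ereal ((L t - L a / R a * R t) * R t))"

definition R_formula :: "real \<Rightarrow> real \<Rightarrow> (real \<Rightarrow> real) \<Rightarrow> real \<Rightarrow> real \<Rightarrow> real" where
  "R_formula a r lam lam1 t =
     (r * (exp (r * (a - t)) + r * integral {t..a} (\<lambda>s. lam s / (lam1 - lam s) * exp (r * (s - t)))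
             + lam t / (lam1 - lam t))
      / (exp (r * (a - t)) + r * integral {t..a} (\<lambda>s. lam s / (lam1 - lam s) * exp (r * (s - t))))\<^sup>2)
     powr (- 1 / 2)"

definition L_formula :: "real \<Rightarrow> real \<Rightarrow> (real \<Rightarrow> real) \<Rightarrow> real \<Rightarrow> real \<Rightarrow> real" where
  "L_formula a r lam lam1 t =
     (r * (exp (r * (t - a)) + r * integral {a..t} (\<lambda>s. lam s / (lam1 - lam s) * exp (r * (t - s)))
             + lam t / (lam1 - lam t))
      / (exp (r * (t - a)) + r * integral {a..t} (\<lambda>s. lam s / (lam1 - lam s) * exp (r * (t - s))))\<^sup>2)
     powr (- 1 / 2)"

end

theory Submission
  imports Defs
begin

text \<open>
  Dirichlet solutions with point interactions at finitely many knots are exactly the functions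
  \<open>y(x) = \<Sum>s. \<kappa>(s) y(s) G(x,s)\<close>, where \<open>G(x,s) = L(min x s) R(max x s)\<close> is Green's function of
  \<open>-y'' + q y\<close> (\<open>dirichlet_solution_eq_green_sum\<close>, \<open>green_sum_dirichlet_solution\<close>). The reason is that
  on each interval without knots \<open>y\<close> is a combination of \<open>L\<close> and \<open>R\<close>: its Wronskians with \<open>L\<close> and \<open>R\<close> are
  absolutely continuous with derivative zero almost everywhere, hence constant.

  The eigenvalue problem with knots \<open>a\<close> and \<open>t\<close> is therefore a system of two linear equations, and it has the
  single eigenvalue
  \<open>\<lambda>(t) = (1 - r G(t,t)) / (w\<^sub>0 (G(a,a) (1 - r G(t,t)) + r G(a,t)\<^sup>2))\<close>, which for \<open>t = 0\<close> and \<open>t = 1\<close> reduces to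
  \<open>\<lambda>\<^sub>1 = 1 / (w\<^sub>0 G(a,a))\<close> (\<open>first_eigenvalue_eq\<close>). The bound on \<open>r\<close> says that the denominator is positive.
  It also yields \<open>L > 0\<close> and \<open>R > 0\<close> on \<open>(0,1)\<close>: the quotients in it must be positive, and at a zero
  of \<open>L\<close> in \<open>(0,a]\<close> the first one would change its sign (\<open>solutions_pos\<close>).

  Now scale the pair such that \<open>L(a) = R(a)\<close>. For \<open>t \<le> a\<close>, the quotient \<open>\<rho> = \<lambda> / (\<lambda>\<^sub>1 - \<lambda>)\<close> becomes
  \<open>1 / (r L\<^sup>2) - R / L\<close>. As \<open>Z = R / L\<close> satisfies \<open>Z' = -1 / L\<^sup>2\<close>, this is a first order linear equation
  for \<open>Z\<close>, with the solution \<open>Z(t) = exp (r (a - t)) + r \<integral>\<^sub>t\<^sup>a \<rho>(s) exp (r (s - t)) ds\<close>, and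
  \<open>1 / R\<^sup>2 = r (Z + \<rho>) / Z\<^sup>2\<close> is the formula for \<open>R\<close> (\<open>R_reconstruction\<close>). The right half is symmetric.
  So \<open>\<lambda>\<close> determines \<open>R\<close> on \<open>(0,a]\<close> and \<open>L\<close> on \<open>[a,1)\<close>, and \<open>q\<close> is \<open>R'' / R\<close> and \<open>L'' / L\<close> there.
\<close>

section \<open>Absolute continuity\<close>

definition nonoverlapping_in :: "real set \<Rightarrow> (real \<times> real) set \<Rightarrow> bool" where
  "nonoverlapping_in S D \<longleftrightarrow> finite D \<and> (\<forall>(u, v)\<in>D. u < v \<and> {u..v} \<subseteq> S) \<and>
     disjoint_family_on (\<lambda>(u, v). {u<..<v}) D"

lemma nonoverlapping_in_mem:
  assumes "nonoverlapping_in S D" "(u, v) \<in> D"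
  shows "u \<in> S" "v \<in> S" "u < v"
  using assms unfolding nonoverlapping_in_def by fastforce+

lemma nonoverlapping_in_mono: "nonoverlapping_in T D \<Longrightarrow> T \<subseteq> S \<Longrightarrow> nonoverlapping_in S D"
  unfolding nonoverlapping_in_def by fastforce

lemma abs_cont_on_iff:
  "abs_cont_on S f \<longleftrightarrow> (\<forall>e>0. \<exists>d>0. \<forall>D. nonoverlapping_in S D \<longrightarrow>
     (\<Sum>(u, v)\<in>D. v - u) < d \<longrightarrow> (\<Sum>(u, v)\<in>D. \<bar>f v - f u\<bar>) < e)"
  by (simp only: abs_cont_on_def nonoverlapping_in_def imp_conjL)

lemma abs_cont_onE:
  assumes "abs_cont_on S f" "e > 0"
  obtains d where "d > 0" "\<And>D. nonoverlapping_in S D \<Longrightarrow>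
     (\<Sum>(u, v)\<in>D. v - u) < d \<Longrightarrow> (\<Sum>(u, v)\<in>D. \<bar>f v - f u\<bar>) < e"
  using assms unfolding abs_cont_on_iff by meson

lemma abs_cont_onI:
  assumes "\<And>e. e > 0 \<Longrightarrow> \<exists>d>0. \<forall>D. nonoverlapping_in S D \<longrightarrow>
     (\<Sum>(u, v)\<in>D. v - u) < d \<longrightarrow> (\<Sum>(u, v)\<in>D. \<bar>f v - f u\<bar>) < e"
  shows "abs_cont_on S f"
  using assms unfolding abs_cont_on_iff by simp

lemma abs_cont_on_subset: "abs_cont_on S f \<Longrightarrow> T \<subseteq> S \<Longrightarrow> abs_cont_on T f"
  unfolding abs_cont_on_iff using nonoverlapping_in_mono by meson

text \<open>All closure properties of absolute continuity below are instances of this comparison principle: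
  it suffices that the increments of \<open>h\<close> are controlled by those of \<open>f\<close> and \<open>g\<close>.\<close>

lemma abs_cont_on_dominated:
  assumes f: "abs_cont_on S f" and g: "abs_cont_on S g" and "0 < B"
    and bound: "\<And>u v. u \<in> S \<Longrightarrow> v \<in> S \<Longrightarrow> \<bar>h v - h u\<bar> \<le> B * (\<bar>f v - f u\<bar> + \<bar>g v - g u\<bar>)"
  shows "abs_cont_on S h"
proof (rule abs_cont_onI)
  fix e :: real assume "e > 0"
  define e' where "e' = e / (2 * B)"
  have "e' > 0" using \<open>e > 0\<close> \<open>0 < B\<close> by (simp add: e'_def)
  then obtain d1 where d1: "d1 > 0" "\<And>D. nonoverlapping_in S D \<Longrightarrow>
     (\<Sum>(u, v)\<in>D. v - u) < d1 \<Longrightarrow> (\<Sum>(u, v)\<in>D. \<bar>f v - f u\<bar>) < e'"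
    using abs_cont_onE[OF f] by blast
  obtain d2 where d2: "d2 > 0" "\<And>D. nonoverlapping_in S D \<Longrightarrow>
     (\<Sum>(u, v)\<in>D. v - u) < d2 \<Longrightarrow> (\<Sum>(u, v)\<in>D. \<bar>g v - g u\<bar>) < e'"
    using abs_cont_onE[OF g \<open>e' > 0\<close>] by blast
  show "\<exists>d>0. \<forall>D. nonoverlapping_in S D \<longrightarrow> (\<Sum>(u, v)\<in>D. v - u) < d \<longrightarrow> (\<Sum>(u, v)\<in>D. \<bar>h v - h u\<bar>) < e"
  proof (intro exI[of _ "min d1 d2"] conjI allI impI)
    fix D :: "(real \<times> real) set"
    assume D: "nonoverlapping_in S D" "(\<Sum>(u, v)\<in>D. v - u) < min d1 d2"
    have "(\<Sum>(u, v)\<in>D. \<bar>h v - h u\<bar>) \<le> (\<Sum>(u, v)\<in>D. B * (\<bar>f v - f u\<bar> + \<bar>g v - g u\<bar>))"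
    proof (rule sum_mono, clarify)
      fix u v assume "(u, v) \<in> D"
      then have "u \<in> S" "v \<in> S" using nonoverlapping_in_mem[OF D(1)] by blast+
      then show "\<bar>h v - h u\<bar> \<le> B * (\<bar>f v - f u\<bar> + \<bar>g v - g u\<bar>)" by (rule bound)
    qed
    also have "\<dots> = B * ((\<Sum>(u, v)\<in>D. \<bar>f v - f u\<bar>) + (\<Sum>(u, v)\<in>D. \<bar>g v - g u\<bar>))"
      by (simp add: sum_distrib_left sum.distrib[symmetric] case_prod_unfold)
    also have "\<dots> < B * (e' + e')"
      using d1(2)[of D] d2(2)[of D] D \<open>0 < B\<close> by (intro mult_strict_left_mono add_strict_mono) auto
    also have "\<dots> = e" using \<open>0 < B\<close> by (simp add: e'_def)
    finally show "(\<Sum>(u, v)\<in>D. \<bar>h v - h u\<bar>) < e" .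
  qed (use d1 d2 in auto)
qed

lemma abs_cont_on_cong:
  assumes "abs_cont_on S f" and "\<And>x. x \<in> S \<Longrightarrow> g x = f x"
  shows "abs_cont_on S g"
  by (rule abs_cont_on_dominated[OF assms(1,1), of 1]) (auto simp: assms(2))

lemma abs_cont_on_id: "abs_cont_on S (\<lambda>x. x)"
proof (rule abs_cont_onI)
  fix e :: real assume "e > 0"
  then show "\<exists>d>0. \<forall>D. nonoverlapping_in S D \<longrightarrow> (\<Sum>(u, v)\<in>D. v - u) < d \<longrightarrow> (\<Sum>(u, v)\<in>D. \<bar>v - u\<bar>) < e"
  proof (intro exI[of _ e] conjI allI impI)
    fix D :: "(real \<times> real) set"
    assume D: "nonoverlapping_in S D" "(\<Sum>(u, v)\<in>D. v - u) < e"
    have "(\<Sum>(u, v)\<in>D. \<bar>v - u\<bar>) = (\<Sum>(u, v)\<in>D. v - u)"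
      by (rule sum.cong) (auto dest!: nonoverlapping_in_mem(3)[OF D(1)])
    with D show "(\<Sum>(u, v)\<in>D. \<bar>v - u\<bar>) < e" by simp
  qed
qed

lemma abs_cont_on_lipschitz:
  fixes f :: "real \<Rightarrow> real"
  assumes "C-lipschitz_on S f"
  shows "abs_cont_on S f"
proof (rule abs_cont_on_dominated[OF abs_cont_on_id abs_cont_on_id, of "C + 1"])
  have "C \<ge> 0" using assms by (rule lipschitz_on_nonneg)
  then show "0 < C + 1" by simp
  fix u v assume "u \<in> S" "v \<in> S"
  then have "\<bar>f v - f u\<bar> \<le> C * \<bar>v - u\<bar>"
    using lipschitz_onD[OF assms, of v u] by (simp add: dist_real_def)
  also have "\<dots> \<le> (C + 1) * (\<bar>v - u\<bar> + \<bar>v - u\<bar>)"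
    using \<open>C \<ge> 0\<close> by (intro mult_mono) auto
  finally show "\<bar>f v - f u\<bar> \<le> (C + 1) * (\<bar>v - u\<bar> + \<bar>v - u\<bar>)" .
qed

lemma abs_cont_on_linear_combination:
  assumes "abs_cont_on S f" "abs_cont_on S g"
  shows "abs_cont_on S (\<lambda>x. \<alpha> * f x + \<beta> * g x)"
proof (rule abs_cont_on_dominated[OF assms, of "\<bar>\<alpha>\<bar> + \<bar>\<beta>\<bar> + 1"])
  fix u v
  have "\<bar>\<alpha> * f v + \<beta> * g v - (\<alpha> * f u + \<beta> * g u)\<bar> \<le> \<bar>\<alpha>\<bar> * \<bar>f v - f u\<bar> + \<bar>\<beta>\<bar> * \<bar>g v - g u\<bar>"
    unfolding abs_mult[symmetric] by (rule order_trans[OF _ abs_triangle_ineq]) (simp add: algebra_simps)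
  also have "\<dots> \<le> (\<bar>\<alpha>\<bar> + \<bar>\<beta>\<bar> + 1) * (\<bar>f v - f u\<bar> + \<bar>g v - g u\<bar>)"
    unfolding distrib_left by (intro add_mono mult_right_mono) auto
  finally show "\<bar>\<alpha> * f v + \<beta> * g v - (\<alpha> * f u + \<beta> * g u)\<bar>
      \<le> (\<bar>\<alpha>\<bar> + \<bar>\<beta>\<bar> + 1) * (\<bar>f v - f u\<bar> + \<bar>g v - g u\<bar>)" .
qed auto

lemma abs_cont_on_mult:
  assumes "abs_cont_on S f" "abs_cont_on S g" "bounded (f ` S)" "bounded (g ` S)"
  shows "abs_cont_on S (\<lambda>x. f x * g x)"
proof -
  obtain A where A: "A > 0" "\<And>x. x \<in> S \<Longrightarrow> \<bar>f x\<bar> \<le> A"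
    using assms(3) unfolding bounded_pos by auto
  obtain B where B: "B > 0" "\<And>x. x \<in> S \<Longrightarrow> \<bar>g x\<bar> \<le> B"
    using assms(4) unfolding bounded_pos by auto
  show ?thesis
  proof (rule abs_cont_on_dominated[OF assms(1,2), of "A + B"])
    fix u v assume uv: "u \<in> S" "v \<in> S"
    have "\<bar>f v * g v - f u * g u\<bar> = \<bar>(f v - f u) * g v + f u * (g v - g u)\<bar>"
      by (simp add: algebra_simps)
    also have "\<dots> \<le> \<bar>f v - f u\<bar> * \<bar>g v\<bar> + \<bar>f u\<bar> * \<bar>g v - g u\<bar>"
      unfolding abs_mult[symmetric] by (rule abs_triangle_ineq)
    also have "\<dots> \<le> \<bar>f v - f u\<bar> * (A + B) + (A + B) * \<bar>g v - g u\<bar>"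
      using A B(1) B(2)[OF uv(2)] A(2)[OF uv(1)] by (intro add_mono mult_left_mono mult_right_mono) auto
    finally show "\<bar>f v * g v - f u * g u\<bar> \<le> (A + B) * (\<bar>f v - f u\<bar> + \<bar>g v - g u\<bar>)"
      by (simp add: algebra_simps)
  qed (use A B in simp)
qed

lemma abs_cont_on_imp_uniformly_continuous_on:
  assumes "abs_cont_on S f" "is_interval S"
  shows "uniformly_continuous_on S f"
  unfolding uniformly_continuous_on_def
proof (intro allI impI)
  fix e :: real assume "e > 0"
  then obtain d where d: "d > 0" "\<And>D. nonoverlapping_in S D \<Longrightarrow>
     (\<Sum>(u, v)\<in>D. v - u) < d \<Longrightarrow> (\<Sum>(u, v)\<in>D. \<bar>f v - f u\<bar>) < e"
    using abs_cont_onE[OF assms(1)] by blast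
  have *: "\<bar>f v - f u\<bar> < e" if "u \<in> S" "v \<in> S" "u < v" "v - u < d" for u v
  proof -
    have "{u..v} \<subseteq> S" using that assms(2) unfolding is_interval_1 by fastforce
    then show ?thesis using d(2)[of "{(u, v)}"] that by (simp add: disjoint_family_on_def nonoverlapping_in_def)
  qed
  show "\<exists>d>0. \<forall>x\<in>S. \<forall>x'\<in>S. dist x' x < d \<longrightarrow> dist (f x') (f x) < e"
  proof (intro exI[of _ d] conjI ballI impI)
    fix x x' assume "x \<in> S" "x' \<in> S" "dist x' x < d"
    then show "dist (f x') (f x) < e"
      using *[of x x'] *[of x' x] \<open>e > 0\<close> by (cases x x' rule: linorder_cases) (auto simp: dist_real_def)
  qed (rule d)
qed

text \<open>Take a gauge that is fine enough for the vanishing derivative at good points, and confines the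
  subintervals tagged in the exceptional null set to an open set of small measure. In a fine tagged
  division the first kind of interval contributes little to \<open>f d - f c\<close> because \<open>f\<close> is almost
  stationary there, the second kind because of absolute continuity.\<close>

lemma abs_cont_on_ae_derivative_zero:
  assumes ac: "abs_cont_on {c..d} f" and "c < d"
    and ae: "AE x in lebesgue. x \<in> {c<..<d} \<longrightarrow> (f has_real_derivative 0) (at x)"
  shows "f d = f c"
proof -
  have small: "\<bar>f d - f c\<bar> \<le> (d - c + 1) * e" if "e > 0" for e
  proof -
    obtain \<delta> where \<delta>: "\<delta> > 0" "\<And>D. nonoverlapping_in {c..d} D \<Longrightarrow>
     (\<Sum>(u, v)\<in>D. v - u) < \<delta> \<Longrightarrow> (\<Sum>(u, v)\<in>D. \<bar>f v - f u\<bar>) < e"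
      using abs_cont_onE[OF ac \<open>e > 0\<close>] by blast
    obtain N0 where N0: "N0 \<in> null_sets lebesgue"
        "\<And>x. x \<notin> N0 \<Longrightarrow> x \<in> {c<..<d} \<Longrightarrow> (f has_real_derivative 0) (at x)"
      using AE_E3[OF ae] by auto
    \<comment> \<open>The hypothesis says nothing about the endpoints, so they count as exceptional.\<close>
    define N where "N = insert c (insert d N0)"
    have nullN: "N \<in> null_sets lebesgue"
      unfolding N_def by (metis N0(1) negligible_iff_null_sets negligible_insert)
    have derN: "(f has_real_derivative 0) (at x)" if "x \<in> {c..d}" "x \<notin> N" for x
      using N0(2)[of x] that by (auto simp: N_def)
    obtain U where U: "open U" "N \<subseteq> U" "emeasure lebesgue (U - N) < ennreal \<delta>"
      using sets_lebesgue_outer_open[OF null_setsD2[OF nullN] \<delta>(1)] by metis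
    have "\<exists>\<rho>>0. \<forall>z. \<bar>z - x\<bar> < \<rho> \<longrightarrow> \<bar>f z - f x\<bar> \<le> e * \<bar>z - x\<bar>" if "x \<in> {c..d}" "x \<notin> N" for x
      using derN[OF that] \<open>e > 0\<close>
      unfolding has_field_derivative_def has_derivative_within_alt by auto
    then obtain \<rho> where \<rho>: "\<And>x. x \<in> {c..d} \<Longrightarrow> x \<notin> N \<Longrightarrow> \<rho> x > 0"
      "\<And>x z. x \<in> {c..d} \<Longrightarrow> x \<notin> N \<Longrightarrow> \<bar>z - x\<bar> < \<rho> x \<Longrightarrow> \<bar>f z - f x\<bar> \<le> e * \<bar>z - x\<bar>"
      by metis
    define \<gamma> where "\<gamma> x = (if x \<in> N then U else if x \<in> {c..d} then ball x (\<rho> x) else UNIV)" for x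
    have "gauge \<gamma>"
      unfolding gauge_def \<gamma>_def using U \<rho>(1) by auto
    then obtain p where p: "p tagged_division_of {c..d}" "\<gamma> fine p"
      using fine_division_exists_real by blast
    note pD = tagged_division_ofD[OF p(1)]
    have fin: "finite p" by (rule pD(1))
    have K: "Inf K \<le> Sup K" "{Inf K..Sup K} \<subseteq> K" "x \<in> {Inf K..Sup K}" "x \<in> {c..d}"
        "{Inf K..Sup K} \<subseteq> {c..d}" "K \<subseteq> \<gamma> x" "interior K = {Inf K<..<Sup K}"
      if "(x, K) \<in> p" for x K
    proof -
      obtain l u where lu: "K = cbox l u" using pD(4)[OF \<open>(x, K) \<in> p\<close>] by blast
      have "x \<in> K" by (rule pD(2)[OF that])
      then have "l \<le> u" "K = {l..u}" using lu by auto
      then show "Inf K \<le> Sup K" "{Inf K..Sup K} \<subseteq> K" "x \<in> {Inf K..Sup K}" "x \<in> {c..d}"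
        "{Inf K..Sup K} \<subseteq> {c..d}" "interior K = {Inf K<..<Sup K}"
        using \<open>x \<in> K\<close> pD(3)[OF that] by auto
      show "K \<subseteq> \<gamma> x" using p(2) that by (auto simp: fine_def)
    qed
    define A where "A = {(x, K) \<in> p. x \<in> N}"
    \<comment> \<open>Absolute continuity speaks of nondegenerate intervals only; the others contribute nothing to the sum.\<close>
    define B where "B = {(x, K) \<in> p. x \<in> N \<and> Inf K < Sup K}"
    define g where "g = (\<lambda>(x :: real, K :: real set). (Inf K, Sup K))"
    have subs: "A \<subseteq> p" "B \<subseteq> A" by (auto simp: A_def B_def)
    have finA: "finite A" by (rule finite_subset[OF subs(1) fin])
    have finB: "finite B" by (rule finite_subset[OF subs(2) finA])
    have disj: "{Inf K<..<Sup K} \<inter> {Inf K'<..<Sup K'} = {}"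
      if "(x, K) \<in> p" "(x', K') \<in> p" "(x, K) \<noteq> (x', K')" for x x' K K'
      using pD(5)[OF that] K(7)[OF that(1)] K(7)[OF that(2)] by simp
    have inj: "inj_on g B"
    proof (rule inj_onI)
      fix P Q assume PQ: "P \<in> B" "Q \<in> B" "g P = g Q"
      obtain x K x' K' where eq: "P = (x, K)" "Q = (x', K')" by (cases P, cases Q)
      have p': "(x, K) \<in> p" "(x', K') \<in> p" "Inf K < Sup K" and same: "Inf K = Inf K'" "Sup K = Sup K'"
        using PQ eq by (auto simp: B_def g_def)
      show "P = Q"
      proof (rule ccontr)
        assume "P \<noteq> Q"
        then have "{Inf K<..<Sup K} = {}" using disj[OF p'(1,2)] eq same by simp
        with p'(3) show False by (simp add: greaterThanLessThan_empty_iff)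
      qed
    qed
    define D where "D = g ` B"
    have D1: "finite D" using finB by (simp add: D_def)
    have D2: "\<forall>(u, v)\<in>D. u < v \<and> {u..v} \<subseteq> {c..d}"
    proof clarify
      fix u v assume "(u, v) \<in> D"
      then obtain x K where "(x, K) \<in> p" "u = Inf K" "v = Sup K" "u < v"
        by (auto simp: D_def B_def g_def)
      then show "u < v \<and> {u..v} \<subseteq> {c..d}" using K(5) by blast
    qed
    have D3: "disjoint_family_on (\<lambda>(u, v). {u<..<v}) D"
      unfolding disjoint_family_on_def
    proof (intro ballI impI)
      fix P Q assume PQ: "P \<in> D" "Q \<in> D" "P \<noteq> Q"
      then obtain x K x' K' where *: "(x, K) \<in> p" "(x', K') \<in> p" "P = (Inf K, Sup K)" "Q = (Inf K', Sup K')"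
        by (auto simp: D_def B_def g_def)
      with PQ(3) disj[OF *(1,2)] show "(case P of (u, v) \<Rightarrow> {u<..<v}) \<inter> (case Q of (u, v) \<Rightarrow> {u<..<v}) = {}"
        by auto
    qed
    have D4: "(\<Sum>(u, v)\<in>D. v - u) < \<delta>"
    proof -
      define V where "V = (\<Union>P\<in>D. case P of (u, v) \<Rightarrow> {u<..<v})"
      have "V \<subseteq> U"
      proof
        fix z assume "z \<in> V"
        then obtain x K where *: "(x, K) \<in> p" "x \<in> N" "z \<in> {Inf K<..<Sup K}"
          by (auto simp: V_def D_def B_def g_def)
        then have "z \<in> K" using K(2)[OF *(1)] by auto
        then show "z \<in> U" using K(6)[OF *(1)] *(2) by (auto simp: \<gamma>_def)
      qed
      have Vl: "V \<in> sets lebesgue"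
        unfolding V_def by (intro sets.finite_UN D1) auto
      have "emeasure lebesgue V = emeasure lebesgue (V - N)"
        using emeasure_Diff_null_set[OF nullN Vl] by simp
      also have "\<dots> \<le> emeasure lebesgue (U - N)"
        using \<open>V \<subseteq> U\<close> U(1) nullN by (intro emeasure_mono) auto
      also have "\<dots> < ennreal \<delta>" by (rule U)
      finally have lt: "emeasure lebesgue V < ennreal \<delta>" .
      then have "emeasure lebesgue V = ennreal (measure lebesgue V)"
        by (intro emeasure_eq_ennreal_measure) auto
      with lt have "measure lebesgue V < \<delta>"
        using \<open>\<delta> > 0\<close> by (simp add: ennreal_less_iff)
      also have "measure lebesgue V = (\<Sum>P\<in>D. measure lebesgue (case P of (u, v) \<Rightarrow> {u<..<v}))"
        unfolding V_def using D1 D2 D3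
        by (intro measure_finite_Union) (auto simp: case_prod_unfold)
      also have "\<dots> = (\<Sum>(u, v)\<in>D. v - u)"
        using D2 by (intro sum.cong) auto
      finally show ?thesis .
    qed
    have sumA: "(\<Sum>(x, K)\<in>A. \<bar>f (Sup K) - f (Inf K)\<bar>) < e"
    proof -
      have "(\<Sum>(x, K)\<in>A. \<bar>f (Sup K) - f (Inf K)\<bar>) = (\<Sum>(x, K)\<in>B. \<bar>f (Sup K) - f (Inf K)\<bar>)"
      proof (rule sum.mono_neutral_right)
        show "finite A" by (rule finA)
        show "\<forall>i\<in>A - B. (case i of (x, K) \<Rightarrow> \<bar>f (Sup K) - f (Inf K)\<bar>) = 0"
        proof clarify
          fix x K assume *: "(x, K) \<in> A" "(x, K) \<notin> B"
          then have "(x, K) \<in> p" by (auto simp: A_def)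
          then have "Inf K = Sup K" using * K(1)[of x K] by (auto simp: A_def B_def)
          then show "\<bar>f (Sup K) - f (Inf K)\<bar> = 0" by simp
        qed
      qed (rule subs)
      also have "\<dots> = (\<Sum>(u, v)\<in>D. \<bar>f v - f u\<bar>)"
        unfolding D_def by (subst sum.reindex[OF inj]) (auto intro!: sum.cong simp: g_def)
      also have "\<dots> < e" using \<delta>(2)[of D] D1 D2 D3 D4 by (simp add: nonoverlapping_in_def)
      finally show ?thesis .
    qed
    have sumB: "(\<Sum>(x, K)\<in>p - A. \<bar>f (Sup K) - f (Inf K)\<bar>) \<le> e * (d - c)"
    proof -
      have "(\<Sum>(x, K)\<in>p - A. \<bar>f (Sup K) - f (Inf K)\<bar>) \<le> (\<Sum>(x, K)\<in>p - A. e * (Sup K - Inf K))"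
      proof (rule sum_mono, clarify)
        fix x K assume *: "(x, K) \<in> p" "(x, K) \<notin> A"
        then have xN: "x \<notin> N" by (auto simp: A_def)
        note KK = K[OF *(1)]
        have "Inf K \<in> K" "Sup K \<in> K" using KK(1,2) by auto
        then have "Inf K \<in> ball x (\<rho> x)" "Sup K \<in> ball x (\<rho> x)"
          using KK(4,6) xN by (auto simp: \<gamma>_def)
        then have "\<bar>f (Inf K) - f x\<bar> \<le> e * \<bar>Inf K - x\<bar>" "\<bar>f (Sup K) - f x\<bar> \<le> e * \<bar>Sup K - x\<bar>"
          using \<rho>(2)[OF KK(4) xN, of "Inf K"] \<rho>(2)[OF KK(4) xN, of "Sup K"]
          by (auto simp: dist_real_def abs_minus_commute)
        moreover have "\<bar>Inf K - x\<bar> = x - Inf K" "\<bar>Sup K - x\<bar> = Sup K - x" using KK(3) by auto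
        ultimately show "\<bar>f (Sup K) - f (Inf K)\<bar> \<le> e * (Sup K - Inf K)"
          by (simp add: algebra_simps)
      qed
      also have "\<dots> \<le> (\<Sum>(x, K)\<in>p. e * (Sup K - Inf K))"
        using fin \<open>e > 0\<close> K(1) by (intro sum_mono2) auto
      also have "\<dots> = e * (\<Sum>(x, K)\<in>p. Sup K - Inf K)"
        by (simp add: sum_distrib_left case_prod_unfold)
      also have "\<dots> = e * (d - c)"
        using additive_tagged_division_1[of c d p "\<lambda>x. x"] p(1) \<open>c < d\<close> by simp
      finally show ?thesis .
    qed
    have "\<bar>f d - f c\<bar> = \<bar>\<Sum>(x, K)\<in>p. f (Sup K) - f (Inf K)\<bar>"
      using additive_tagged_division_1[of c d p f] p(1) \<open>c < d\<close> by simp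
    also have "\<dots> \<le> (\<Sum>(x, K)\<in>p. \<bar>f (Sup K) - f (Inf K)\<bar>)"
      by (rule order_trans[OF sum_abs]) (simp add: case_prod_unfold)
    also have "\<dots> = (\<Sum>(x, K)\<in>p - A. \<bar>f (Sup K) - f (Inf K)\<bar>) + (\<Sum>(x, K)\<in>A. \<bar>f (Sup K) - f (Inf K)\<bar>)"
      by (rule sum.subset_diff[OF subs(1) fin])
    also have "\<dots> \<le> (d - c + 1) * e"
      using sumA sumB by (simp add: algebra_simps)
    finally show ?thesis .
  qed
  have "\<bar>f d - f c\<bar> \<le> 0"
  proof (rule field_le_epsilon)
    fix e :: real assume "e > 0"
    have "(d - c + 1) * (e / (d - c + 1)) = e" using \<open>c < d\<close> by simp
    moreover have "e / (d - c + 1) > 0" using \<open>e > 0\<close> \<open>c < d\<close> by simp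
    ultimately show "\<bar>f d - f c\<bar> \<le> 0 + e" using small by fastforce
  qed
  then show ?thesis by simp
qed

section \<open>Wronskians and solutions of the differential equation\<close>

text \<open>The equation \<open>y'' = q y\<close> on an open interval, without any condition at its ends. A solution of a
  problem with point interactions is one of these on each interval between consecutive knots.\<close>

definition solves_on :: "(real \<Rightarrow> real) \<Rightarrow> real set \<Rightarrow> (real \<Rightarrow> real) \<Rightarrow> bool" where
  "solves_on q I y \<longleftrightarrow> (\<forall>x\<in>I. y differentiable (at x)) \<and> abs_cont_on I (deriv y) \<and>
     (AE x in lebesgue. x \<in> I \<longrightarrow> (deriv y has_real_derivative q x * y x) (at x))"

lemma solves_onD:
  assumes "solves_on q I y"
  shows "x \<in> I \<Longrightarrow> (y has_real_derivative deriv y x) (at x)" and "abs_cont_on I (deriv y)"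
    and "AE x in lebesgue. x \<in> I \<longrightarrow> (deriv y has_real_derivative q x * y x) (at x)"
  using assms by (auto simp: solves_on_def DERIV_deriv_iff_real_differentiable)

lemma solves_on_subset: "solves_on q I y \<Longrightarrow> J \<subseteq> I \<Longrightarrow> solves_on q J y"
  unfolding solves_on_def by (auto intro: abs_cont_on_subset elim!: eventually_mono)

lemma lipschitz_on_of_bounded_derivative:
  fixes f :: "real \<Rightarrow> real"
  assumes "convex S" "B \<ge> 0"
    and "\<And>x. x \<in> S \<Longrightarrow> (f has_real_derivative f' x) (at x within S)"
    and "\<And>x. x \<in> S \<Longrightarrow> \<bar>f' x\<bar> \<le> B"
  shows "B-lipschitz_on S f"
  using assms by (intro bounded_derivative_imp_lipschitz[where f' = "\<lambda>x. (*) (f' x)"])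
    (auto simp: has_field_derivative_def abs_mult mult_right_mono intro!: onorm_le)

text \<open>The Wronskian is absolutely continuous, and its derivative \<open>y z'' - y'' z = y q z - q y z\<close>
  vanishes almost everywhere.\<close>

lemma wronskian_constant:
  assumes y: "solves_on q {u<..<v} y" and z: "solves_on q {u<..<v} z"
    and "c \<in> {u<..<v}" "d \<in> {u<..<v}"
  shows "y c * deriv z c - deriv y c * z c = y d * deriv z d - deriv y d * z d"
proof -
  have main: "y c * deriv z c - deriv y c * z c = y d * deriv z d - deriv y d * z d"
    if cd: "c \<in> {u<..<v}" "d \<in> {u<..<v}" "c < d" for c d
  proof -
    have sub: "{c..d} \<subseteq> {u<..<v}" using cd by auto
    define W where "W x = y x * deriv z x - deriv y x * z x" for x
    have ac: "abs_cont_on {c..d} f \<and> abs_cont_on {c..d} (deriv f) \<and> bounded (f ` {c..d}) \<and>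
        bounded (deriv f ` {c..d})" if f: "solves_on q {u<..<v} f" for f
    proof -
      have ac': "abs_cont_on {c..d} (deriv f)"
        using abs_cont_on_subset[OF solves_onD(2)[OF f] sub] .
      have cont': "continuous_on {c..d} (deriv f)"
        by (intro uniformly_continuous_imp_continuous abs_cont_on_imp_uniformly_continuous_on ac') simp
      then have b': "bounded (deriv f ` {c..d})"
        by (intro compact_imp_bounded compact_continuous_image) auto
      then obtain B where B: "B \<ge> 0" "\<And>x. x \<in> {c..d} \<Longrightarrow> \<bar>deriv f x\<bar> \<le> B"
        unfolding bounded_pos by (metis imageI less_imp_le real_norm_def)
      have der: "(f has_real_derivative deriv f x) (at x within {c..d})" if "x \<in> {c..d}" for x
        using solves_onD(1)[OF f] sub that by (blast intro: has_field_derivative_at_within)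
      have "B-lipschitz_on {c..d} f"
        using B der by (intro lipschitz_on_of_bounded_derivative) auto
      then have "abs_cont_on {c..d} f" by (rule abs_cont_on_lipschitz)
      moreover have "continuous_on {c..d} f" using der DERIV_continuous_on by blast
      then have "bounded (f ` {c..d})" by (intro compact_imp_bounded compact_continuous_image) auto
      ultimately show ?thesis using ac' b' by blast
    qed
    have "abs_cont_on {c..d} (\<lambda>x. 1 * (y x * deriv z x) + (-1) * (deriv y x * z x))"
      using ac[OF y] ac[OF z] by (intro abs_cont_on_linear_combination abs_cont_on_mult) auto
    then have acW: "abs_cont_on {c..d} W" by (simp add: W_def[abs_def])
    have "AE x in lebesgue. x \<in> {c<..<d} \<longrightarrow> (W has_real_derivative 0) (at x)"
      using solves_onD(3)[OF y] solves_onD(3)[OF z]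
    proof eventually_elim
      case (elim x)
      show ?case
      proof
        assume "x \<in> {c<..<d}"
        then have x: "x \<in> {u<..<v}" using cd by auto
        have "(W has_real_derivative y x * (q x * z x) + deriv y x * deriv z x
            - (deriv y x * deriv z x + q x * y x * z x)) (at x)"
          unfolding W_def[abs_def] using elim x solves_onD(1)[OF y x] solves_onD(1)[OF z x]
          by (auto intro!: derivative_eq_intros)
        then show "(W has_real_derivative 0) (at x)" by (simp add: algebra_simps)
      qed
    qed
    from abs_cont_on_ae_derivative_zero[OF acW \<open>c < d\<close> this] show ?thesis by (simp add: W_def)
  qed
  show ?thesis
  proof (cases c d rule: linorder_cases)
    case less
    then show ?thesis by (rule main[OF assms(3,4)])
  next
    case greater
    then show ?thesis by (rule main[OF assms(4,3), symmetric])
  qed simp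
qed

text \<open>The coefficients are the Wronskians of \<open>y\<close> with \<open>L\<close> and \<open>R\<close>, which are constants; this replaces
  a uniqueness theorem for the initial value problem.\<close>

lemma solution_is_combination:
  assumes L: "solves_on q {u<..<v} L" and R: "solves_on q {u<..<v} R" and y: "solves_on q {u<..<v} y"
    and W: "\<And>x. x \<in> {u<..<v} \<Longrightarrow> L x * deriv R x - deriv L x * R x = -1"
  shows "\<exists>\<alpha> \<beta>. \<forall>x\<in>{u<..<v}. y x = \<alpha> * L x + \<beta> * R x"
proof (cases "u < v")
  case True
  define c where "c = (u + v) / 2"
  have c: "c \<in> {u<..<v}" using True by (auto simp: c_def)
  define A B where "A = y c * deriv R c - deriv y c * R c" and "B = y c * deriv L c - deriv y c * L c"
  have "y x = (- A) * L x + B * R x" if x: "x \<in> {u<..<v}" for x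
  proof -
    have AB: "A = y x * deriv R x - deriv y x * R x" "B = y x * deriv L x - deriv y x * L x"
      unfolding A_def B_def by (rule wronskian_constant[OF y R c x] wronskian_constant[OF y L c x])+
    have "(- A) * L x + B * R x = - y x * (L x * deriv R x - deriv L x * R x)"
      unfolding AB by (simp add: algebra_simps)
    also have "\<dots> = y x" using W[OF x] by simp
    finally show ?thesis by simp
  qed
  then show ?thesis by blast
qed simp

lemma solves_on_of_combination:
  assumes L: "solves_on q {u<..<v} L" and R: "solves_on q {u<..<v} R"
    and y: "\<And>x. x \<in> {u<..<v} \<Longrightarrow> y x = \<alpha> * L x + \<beta> * R x"
  shows "solves_on q {u<..<v} y"
proof -
  have der: "(y has_real_derivative \<alpha> * deriv L x + \<beta> * deriv R x) (at x)" if x: "x \<in> {u<..<v}" for x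
  proof -
    have "((\<lambda>x. \<alpha> * L x + \<beta> * R x) has_real_derivative \<alpha> * deriv L x + \<beta> * deriv R x) (at x)"
      using solves_onD(1)[OF L x] solves_onD(1)[OF R x] by (auto intro!: derivative_eq_intros)
    then show ?thesis
      by (rule has_field_derivative_transform_within_open[where S = "{u<..<v}"]) (use x y in auto)
  qed
  have dy: "deriv y x = \<alpha> * deriv L x + \<beta> * deriv R x" if "x \<in> {u<..<v}" for x
    using der[OF that] by (rule DERIV_imp_deriv)
  show ?thesis
    unfolding solves_on_def
  proof (intro conjI ballI)
    show "y differentiable (at x)" if "x \<in> {u<..<v}" for x
      using der[OF that] real_differentiable_def by blast
    show "abs_cont_on {u<..<v} (deriv y)"
      by (rule abs_cont_on_cong[OF abs_cont_on_linear_combination[OF solves_onD(2)[OF L] solves_onD(2)[OF R]] dy])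
    show "AE x in lebesgue. x \<in> {u<..<v} \<longrightarrow> (deriv y has_real_derivative q x * y x) (at x)"
      using solves_onD(3)[OF L] solves_onD(3)[OF R]
    proof eventually_elim
      case (elim x)
      show ?case
      proof
        assume x: "x \<in> {u<..<v}"
        have "((\<lambda>x. \<alpha> * deriv L x + \<beta> * deriv R x) has_real_derivative q x * y x) (at x)"
          using elim x y[OF x] by (auto intro!: derivative_eq_intros simp: algebra_simps)
        then show "(deriv y has_real_derivative q x * y x) (at x)"
          by (rule has_field_derivative_transform_within_open[where S = "{u<..<v}"]) (use x dy in auto)
      qed
    qed
  qed
qed

lemma delta_solution_iff:
  "delta_solution q S \<kappa> y \<longleftrightarrow> abs_cont_on {0..1} y \<and>
     (\<forall>u\<in>{0, 1} \<union> S. \<forall>v\<in>{0, 1} \<union> S. 0 \<le> u \<and> u < v \<and> v \<le> 1 \<and> {u<..<v} \<inter> S = {} \<longrightarrow>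
        (\<forall>x\<in>{u<..<v}. y differentiable (at x)) \<and> abs_cont_on {u<..<v} (deriv y) \<and>
        y differentiable (at_right u) \<and> y differentiable (at_left v)) \<and>
     (AE x in lebesgue. x \<in> {0<..<1} - S \<longrightarrow> (deriv y has_real_derivative q x * y x) (at x)) \<and>
     (\<forall>s\<in>S \<inter> {0<..<1}.
        \<exists>m p. (y has_real_derivative m) (at_left s) \<and> (y has_real_derivative p) (at_right s) \<and>
              m - p = \<kappa> s * y s)"
proof -
  have "(\<exists>y2. (deriv y has_real_derivative y2) (at x) \<and> - y2 + q x * y x = 0) \<longleftrightarrow>
      (deriv y has_real_derivative q x * y x) (at x)" for x
    by (auto simp: algebra_simps)
  then show ?thesis unfolding delta_solution_def by simp
qed

lemma delta_solution_imp_solves_on: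
  assumes "delta_solution q S \<kappa> y" "u \<in> {0, 1} \<union> S" "v \<in> {0, 1} \<union> S" "0 \<le> u" "u < v" "v \<le> 1"
    "{u<..<v} \<inter> S = {}"
  shows "solves_on q {u<..<v} y" "y differentiable (at_right u)" "y differentiable (at_left v)"
proof -
  have "(\<forall>x\<in>{u<..<v}. y differentiable (at x)) \<and> abs_cont_on {u<..<v} (deriv y) \<and>
        y differentiable (at_right u) \<and> y differentiable (at_left v)"
    and ae: "AE x in lebesgue. x \<in> {0<..<1} - S \<longrightarrow> (deriv y has_real_derivative q x * y x) (at x)"
    using assms unfolding delta_solution_iff by blast+
  moreover have "AE x in lebesgue. x \<in> {u<..<v} \<longrightarrow> (deriv y has_real_derivative q x * y x) (at x)"
    using ae
  proof eventually_elim
    case (elim x)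
    show ?case
    proof
      assume "x \<in> {u<..<v}"
      then have "x \<in> {0<..<1} - S" using assms(4,6,7) by fastforce
      with elim show "(deriv y has_real_derivative q x * y x) (at x)" by blast
    qed
  qed
  ultimately show "solves_on q {u<..<v} y" "y differentiable (at_right u)" "y differentiable (at_left v)"
    unfolding solves_on_def by blast+
qed

lemma regular_solution_has_derivative:
  assumes "delta_solution q {} \<kappa> y" "x \<in> {0..1}"
  shows "(y has_real_derivative deriv01 y x) (at x within {0..1})"
proof -
  note sol = delta_solution_imp_solves_on[OF assms(1), of 0 1, simplified]
  have "y differentiable (at x within {0..1})"
  proof -
    consider "x = 0" | "x = 1" | "x \<in> {0<..<1}" using assms(2) by fastforce
    then show ?thesis
    proof cases
      case 3
      then show ?thesis
        using sol(1) by (auto simp: solves_on_def intro: differentiable_at_withinI)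
    qed (use sol(2,3) in \<open>simp_all add: at_within_Icc_at_right at_within_Icc_at_left\<close>)
  qed
  then show ?thesis
    by (simp add: vector_derivative_works has_real_derivative_iff_has_vector_derivative)
qed

lemma deriv01_eq:
  assumes "(y has_real_derivative D) (at x within {0..1})" "x \<in> {0..1}"
  shows "deriv01 y x = D"
  using assms by (intro vector_derivative_within_closed_interval)
    (auto simp: has_real_derivative_iff_has_vector_derivative)

lemma regular_solution_deriv:
  assumes "delta_solution q {} \<kappa> y" "x \<in> {0<..<1}"
  shows "(y has_real_derivative deriv01 y x) (at x)" "deriv y x = deriv01 y x"
proof -
  show "(y has_real_derivative deriv01 y x) (at x)"
    using regular_solution_has_derivative[OF assms(1), of x] assms(2)
    by (simp add: at_within_Icc_at)
  then show "deriv y x = deriv01 y x" by (rule DERIV_imp_deriv)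
qed

text \<open>The derivative is absolutely continuous on a bounded interval, hence bounded.\<close>

lemma regular_solution_lipschitz:
  assumes "delta_solution q {} \<kappa> y"
  shows "\<exists>B. B-lipschitz_on {0..1} y"
proof -
  note sol = delta_solution_imp_solves_on[OF assms(1), of 0 1, simplified]
  have "uniformly_continuous_on {0<..<1} (deriv y)"
    by (intro abs_cont_on_imp_uniformly_continuous_on solves_onD(2)[OF sol(1)]) simp
  then have "bounded (deriv y ` {0<..<1})"
    by (rule bounded_uniformly_continuous_image) (metis bounded_box box_real(1))
  then obtain B where B: "\<And>x. x \<in> {0<..<1} \<Longrightarrow> \<bar>deriv y x\<bar> \<le> B"
    unfolding bounded_pos by (metis imageI real_norm_def)
  define C where "C = Max {B, \<bar>deriv01 y 0\<bar>, \<bar>deriv01 y 1\<bar>}"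
  have C: "\<bar>deriv01 y x\<bar> \<le> C" if x01: "x \<in> {0..1}" for x
  proof -
    consider "x = 0" | "x = 1" | "x \<in> {0<..<1}" using x01 by fastforce
    then show ?thesis
    proof cases
      case 3
      then have "\<bar>deriv01 y x\<bar> \<le> B" using B regular_solution_deriv[OF assms] by metis
      then show ?thesis by (simp add: C_def)
    qed (simp_all add: C_def)
  qed
  have "C-lipschitz_on {0..1} y"
    using order_trans[OF abs_ge_zero C[of 0]] C regular_solution_has_derivative[OF assms]
    by (intro lipschitz_on_of_bounded_derivative) auto
  then show ?thesis ..
qed

section \<open>Green's function\<close>

text \<open>Green's function of \<open>-y'' + q y\<close> with Dirichlet conditions, for \<open>W[L,R] = -1\<close>.\<close>

definition green :: "(real \<Rightarrow> real) \<Rightarrow> (real \<Rightarrow> real) \<Rightarrow> real \<Rightarrow> real \<Rightarrow> real" where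
  "green L R x s = L (min x s) * R (max x s)"

lemma green_commute: "green L R x s = green L R s x"
  by (simp add: green_def min.commute max.commute)

text \<open>Each \<open>x\<close> has a one-sided neighbourhood inside an interval between consecutive knots.\<close>

lemma gap_left_of:
  fixes K :: "real set"
  assumes "finite K" "0 \<in> K" "1 \<in> K" "0 < x" "x \<le> 1"
  shows "\<exists>u\<in>K. \<exists>v\<in>K. 0 \<le> u \<and> u < x \<and> x \<le> v \<and> v \<le> 1 \<and> {u<..<v} \<inter> K = {}"
proof -
  define u v where "u = Max {k \<in> K. k < x}" and "v = Min {k \<in> K. x \<le> k}"
  have u: "u \<in> {k \<in> K. k < x}" unfolding u_def using assms by (intro Max_in) auto
  have v: "v \<in> {k \<in> K. x \<le> k}" unfolding v_def using assms by (intro Min_in) auto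
  have u': "k \<le> u" if "k \<in> K" "k < x" for k unfolding u_def using assms that by (intro Max_ge) auto
  have v': "v \<le> k" if "k \<in> K" "x \<le> k" for k unfolding v_def using assms that by (intro Min_le) auto
  have "{u<..<v} \<inter> K = {}" using u' v' by (force simp: not_less)
  then show ?thesis using u v u'[of 0] v'[of 1] assms by auto
qed

lemma gap_right_of:
  fixes K :: "real set"
  assumes "finite K" "0 \<in> K" "1 \<in> K" "0 \<le> x" "x < 1"
  shows "\<exists>u\<in>K. \<exists>v\<in>K. 0 \<le> u \<and> u \<le> x \<and> x < v \<and> v \<le> 1 \<and> {u<..<v} \<inter> K = {}"
proof -
  define u v where "u = Max {k \<in> K. k \<le> x}" and "v = Min {k \<in> K. x < k}"
  have u: "u \<in> {k \<in> K. k \<le> x}" unfolding u_def using assms by (intro Max_in) auto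
  have v: "v \<in> {k \<in> K. x < k}" unfolding v_def using assms by (intro Min_in) auto
  have u': "k \<le> u" if "k \<in> K" "k \<le> x" for k unfolding u_def using assms that by (intro Max_ge) auto
  have v': "v \<le> k" if "k \<in> K" "x < k" for k unfolding v_def using assms that by (intro Min_le) auto
  have "{u<..<v} \<inter> K = {}" using u' v' by (force simp: not_less)
  then show ?thesis using u v u'[of 0] v'[of 1] assms by auto
qed

lemma has_real_derivative_split_at:
  assumes "(f has_real_derivative D) (at_left x)" "(f has_real_derivative D) (at_right x)"
  shows "(f has_real_derivative D) (at x)"
  using assms unfolding has_field_derivative_iff by (rule filterlim_split_at)

locale wronskian_pair =
  fixes q L R :: "real \<Rightarrow> real"
  assumes pair: "fundamental_pair q L R"
begin

abbreviation G where "G \<equiv> green L R"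

lemma solution: "delta_solution q {} (\<lambda>_. 0) L" "delta_solution q {} (\<lambda>_. 0) R"
  and boundary: "L 0 = 0" "R 1 = 0" "deriv01 L 0 > 0" "deriv01 R 1 < 0"
  and wronskian01: "x \<in> {0..1} \<Longrightarrow> L x * deriv01 R x - deriv01 L x * R x = -1"
  using pair unfolding fundamental_pair_def by blast+

lemma solves: "solves_on q {0<..<1} L" "solves_on q {0<..<1} R"
  using delta_solution_imp_solves_on(1)[OF solution(1), of 0 1]
    delta_solution_imp_solves_on(1)[OF solution(2), of 0 1] by auto

lemma nonzero_at_ends: "R 0 \<noteq> 0" "L 1 \<noteq> 0"
  using wronskian01[of 0] wronskian01[of 1] boundary by auto

lemma has_derivative01:
  "x \<in> {0..1} \<Longrightarrow> (L has_real_derivative deriv01 L x) (at x within {0..1})"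
  "x \<in> {0..1} \<Longrightarrow> (R has_real_derivative deriv01 R x) (at x within {0..1})"
  using regular_solution_has_derivative solution by blast+

lemma has_derivative:
  "x \<in> {0<..<1} \<Longrightarrow> (L has_real_derivative deriv L x) (at x within A)"
  "x \<in> {0<..<1} \<Longrightarrow> (R has_real_derivative deriv R x) (at x within A)"
  using solves_onD(1)[OF solves(1)] solves_onD(1)[OF solves(2)]
  by (auto intro: has_field_derivative_at_within)

lemma wronskian: "x \<in> {0<..<1} \<Longrightarrow> L x * deriv R x - deriv L x * R x = -1"
  using wronskian01[of x] regular_solution_deriv(2)[OF solution(1)] regular_solution_deriv(2)[OF solution(2)]
  by simp

lemma continuous: "continuous_on {0..1} L" "continuous_on {0..1} R"
  by (rule DERIV_continuous_on[OF has_derivative01(1)] DERIV_continuous_on[OF has_derivative01(2)], assumption)+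

text \<open>On the diagonal \<open>G\<close> has a kink, so no derivative is available; but \<open>min\<close> and \<open>max\<close> are Lipschitz.\<close>

lemma abs_cont_green:
  assumes "s \<in> {0..1}"
  shows "abs_cont_on {0..1} (\<lambda>x. G x s)"
proof -
  obtain A B where A: "A-lipschitz_on {0..1} L" and B: "B-lipschitz_on {0..1} R"
    using regular_solution_lipschitz solution by blast
  have min: "1-lipschitz_on {0..1} (\<lambda>x. min x s)"
    by (rule lipschitz_onI) (auto simp: dist_real_def)
  have max: "1-lipschitz_on {0..1} (\<lambda>x. max x s)"
    by (rule lipschitz_onI) (auto simp: dist_real_def)
  have Lm: "(A * 1)-lipschitz_on {0..1} (\<lambda>x. L (min x s))"
    using assms by (intro lipschitz_on_compose2[OF min] lipschitz_on_subset[OF A]) auto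
  have Rm: "(B * 1)-lipschitz_on {0..1} (\<lambda>x. R (max x s))"
    using assms by (intro lipschitz_on_compose2[OF max] lipschitz_on_subset[OF B]) auto
  have bounded: "bounded (f ` {0..1})" if "C-lipschitz_on {0..1} f" for C and f :: "real \<Rightarrow> real"
    by (intro compact_imp_bounded compact_continuous_image lipschitz_on_continuous_on[OF that]) simp
  show ?thesis
    unfolding green_def
    by (intro abs_cont_on_mult abs_cont_on_lipschitz[OF Lm] abs_cont_on_lipschitz[OF Rm]
        bounded[OF Lm] bounded[OF Rm])
qed

lemma green_left_derivative:
  assumes "x \<in> {0<..<1}" "s \<in> {0<..<1}"
  shows "((\<lambda>t. G t s) has_real_derivative (if x \<le> s then deriv L x * R s else L s * deriv R x)) (at_left x)"
proof (cases "x \<le> s")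
  case True
  have "((\<lambda>t. L t * R s) has_real_derivative deriv L x * R s) (at_left x)"
    by (rule DERIV_cmult_right[OF has_derivative(1)[OF assms(1)]])
  moreover have "\<forall>\<^sub>F t in at_left x. G t s = L t * R s"
    using True by (auto simp: eventually_at_filter green_def)
  ultimately show ?thesis
    using True by (subst has_field_derivative_cong_eventually[where g = "\<lambda>t. L t * R s"]) (auto simp: green_def)
next
  case False
  have "((\<lambda>t. L s * R t) has_real_derivative L s * deriv R x) (at_left x)"
    by (rule DERIV_cmult[OF has_derivative(2)[OF assms(1)]])
  moreover have "\<forall>\<^sub>F t in at_left x. s < t"
    using eventually_at_left_real[of s x] False by (auto elim!: eventually_mono)
  then have "\<forall>\<^sub>F t in at_left x. G t s = L s * R t"
    by (auto elim!: eventually_mono simp: green_def)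
  ultimately show ?thesis
    using False by (subst has_field_derivative_cong_eventually[where g = "\<lambda>t. L s * R t"]) (auto simp: green_def)
qed

lemma green_right_derivative:
  assumes "x \<in> {0<..<1}" "s \<in> {0<..<1}"
  shows "((\<lambda>t. G t s) has_real_derivative (if x < s then deriv L x * R s else L s * deriv R x)) (at_right x)"
proof (cases "x < s")
  case True
  have "((\<lambda>t. L t * R s) has_real_derivative deriv L x * R s) (at_right x)"
    by (rule DERIV_cmult_right[OF has_derivative(1)[OF assms(1)]])
  moreover have "\<forall>\<^sub>F t in at_right x. t < s"
    using True by (simp add: eventually_at_right) metis
  then have "\<forall>\<^sub>F t in at_right x. G t s = L t * R s"
    by (auto elim!: eventually_mono simp: green_def)
  ultimately show ?thesis
    using True by (subst has_field_derivative_cong_eventually[where g = "\<lambda>t. L t * R s"]) (auto simp: green_def)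
next
  case False
  have "((\<lambda>t. L s * R t) has_real_derivative L s * deriv R x) (at_right x)"
    by (rule DERIV_cmult[OF has_derivative(2)[OF assms(1)]])
  moreover have "\<forall>\<^sub>F t in at_right x. G t s = L s * R t"
    using False by (auto simp: eventually_at_filter green_def)
  ultimately show ?thesis
    using False by (subst has_field_derivative_cong_eventually[where g = "\<lambda>t. L s * R t"]) (auto simp: green_def)
qed

text \<open>The Wronskian normalization gives \<open>G(-,s)\<close> a unit jump of the derivative at \<open>s\<close>.\<close>

lemma green_sum_derivatives:
  assumes "finite T" "T \<subseteq> {0<..<1}" "x \<in> {0<..<1}"
  shows "\<exists>m p. ((\<lambda>t. \<Sum>s\<in>T. c s * G t s) has_real_derivative m) (at_left x) \<and>
     ((\<lambda>t. \<Sum>s\<in>T. c s * G t s) has_real_derivative p) (at_right x) \<and>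
     m - p = (if x \<in> T then c x else 0)"
proof (intro exI conjI)
  let ?m = "\<lambda>s. if x \<le> s then deriv L x * R s else L s * deriv R x"
  let ?p = "\<lambda>s. if x < s then deriv L x * R s else L s * deriv R x"
  show "((\<lambda>t. \<Sum>s\<in>T. c s * G t s) has_real_derivative (\<Sum>s\<in>T. c s * ?m s)) (at_left x)"
    using assms(2,3) by (intro DERIV_sum DERIV_cmult green_left_derivative) auto
  show "((\<lambda>t. \<Sum>s\<in>T. c s * G t s) has_real_derivative (\<Sum>s\<in>T. c s * ?p s)) (at_right x)"
    using assms(2,3) by (intro DERIV_sum DERIV_cmult green_right_derivative) auto
  have "(\<Sum>s\<in>T. c s * ?m s) - (\<Sum>s\<in>T. c s * ?p s) = (\<Sum>s\<in>T. c s * (?m s - ?p s))"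
    by (simp add: sum_subtractf right_diff_distrib)
  also have "\<dots> = (\<Sum>s\<in>T. if x = s then c s else 0)"
    using wronskian[OF assms(3)] by (intro sum.cong) auto
  also have "\<dots> = (if x \<in> T then c x else 0)"
    by (rule sum.delta'[OF assms(1)])
  finally show "(\<Sum>s\<in>T. c s * ?m s) - (\<Sum>s\<in>T. c s * ?p s) = (if x \<in> T then c x else 0)" .
qed

lemma green_sum_combination:
  assumes "finite T" "{u<..<v} \<inter> T = {}"
  shows "\<exists>\<alpha> \<beta>. \<forall>x\<in>{u..v}. (\<Sum>s\<in>T. c s * G x s) = \<alpha> * L x + \<beta> * R x"
proof (intro exI ballI)
  fix x assume x: "x \<in> {u..v}"
  let ?\<alpha> = "\<lambda>s. if v \<le> s then c s * R s else 0"
  let ?\<beta> = "\<lambda>s. if v \<le> s then 0 else c s * L s"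
  have "c s * G x s = ?\<alpha> s * L x + ?\<beta> s * R x" if "s \<in> T" for s
  proof (cases "v \<le> s")
    case True
    then show ?thesis using x by (simp add: green_def)
  next
    case False
    then have "s \<le> u" using assms(2) that by (metis IntI empty_iff greaterThanLessThan_iff not_le)
    then show ?thesis using x False by (simp add: green_def)
  qed
  then have "(\<Sum>s\<in>T. c s * G x s) = (\<Sum>s\<in>T. ?\<alpha> s * L x + ?\<beta> s * R x)"
    by (rule sum.cong[OF refl])
  then show "(\<Sum>s\<in>T. c s * G x s) = (\<Sum>s\<in>T. ?\<alpha> s) * L x + (\<Sum>s\<in>T. ?\<beta> s) * R x"
    by (simp only: sum.distrib sum_distrib_right)
qed

lemma combination_on_gap:
  assumes "delta_solution q S \<kappa> y" "u \<in> {0, 1} \<union> S" "v \<in> {0, 1} \<union> S"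
    "0 \<le> u" "u < v" "v \<le> 1" "{u<..<v} \<inter> S = {}"
  shows "\<exists>\<alpha> \<beta>. \<forall>x\<in>{u<..<v}. y x = \<alpha> * L x + \<beta> * R x"
proof (rule solution_is_combination)
  have sub: "{u<..<v} \<subseteq> {0<..<1}" using assms by auto
  show "solves_on q {u<..<v} L" "solves_on q {u<..<v} R"
    using solves_on_subset[OF solves(1) sub] solves_on_subset[OF solves(2) sub] .
  show "solves_on q {u<..<v} y"
    using delta_solution_imp_solves_on(1)[OF assms] .
  show "L x * deriv R x - deriv L x * R x = -1" if "x \<in> {u<..<v}" for x
    using wronskian sub that by blast
qed

text \<open>Value and one-sided derivative at a point determine the coefficients of a combination of \<open>L\<close> and
  \<open>R\<close> that is valid on that side.\<close>

lemma combination_coefficients: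
  assumes nt: "at x within A \<noteq> bot" and x: "x \<in> {0<..<1}"
    and ev: "\<forall>\<^sub>F t in at x within A. z t = \<alpha> * L t + \<beta> * R t"
    and der: "(z has_real_derivative D) (at x within A)"
  shows "\<alpha> = - (z x * deriv R x - D * R x)" "\<beta> = z x * deriv L x - D * L x"
proof -
  define f where "f t = z t - (\<alpha> * L t + \<beta> * R t)" for t
  have f': "(f has_real_derivative D - (\<alpha> * deriv L x + \<beta> * deriv R x)) (at x within A)"
    unfolding f_def[abs_def] using der has_derivative[OF x]
    by (auto intro!: derivative_eq_intros)
  have f0: "\<forall>\<^sub>F t in at x within A. f t = 0"
    using ev by (auto elim!: eventually_mono simp: f_def)
  have "(f \<longlongrightarrow> f x) (at x within A)"
    using DERIV_continuous[OF f'] by (simp add: continuous_within)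
  moreover have "(f \<longlongrightarrow> 0) (at x within A)"
    using f0 by (rule tendsto_eventually)
  ultimately have fx: "f x = 0" using nt tendsto_unique by blast
  have "((\<lambda>t. 0) has_real_derivative D - (\<alpha> * deriv L x + \<beta> * deriv R x)) (at x within A)"
    using f' has_field_derivative_cong_eventually[OF f0 fx] by blast
  then have D: "D = \<alpha> * deriv L x + \<beta> * deriv R x"
    using has_field_derivative_unique[OF _ DERIV_const nt, of 0] by force
  have z: "z x = \<alpha> * L x + \<beta> * R x" using fx by (simp add: f_def)
  have "- (z x * deriv R x - D * R x) = - \<alpha> * (L x * deriv R x - deriv L x * R x)"
    unfolding z D by (simp add: algebra_simps)
  then show "\<alpha> = - (z x * deriv R x - D * R x)" using wronskian[OF x] by simp
  have "z x * deriv L x - D * L x = - \<beta> * (L x * deriv R x - deriv L x * R x)"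
    unfolding z D by (simp add: algebra_simps)
  then show "\<beta> = z x * deriv L x - D * L x" using wronskian[OF x] by simp
qed

text \<open>The coefficients, written as Wronskians of \<open>z\<close> with \<open>R\<close> and \<open>L\<close>, agree on the two sides of each point
  because \<open>z\<close> is differentiable there. They are thus locally constant on \<open>(0,1)\<close>, hence constant.\<close>

lemma global_combination:
  assumes der: "\<And>x. x \<in> {0<..<1} \<Longrightarrow> z differentiable (at x)"
    and left: "\<And>x. x \<in> {0<..<1} \<Longrightarrow> \<exists>u<x. \<exists>\<alpha> \<beta>. \<forall>t\<in>{u<..<x}. z t = \<alpha> * L t + \<beta> * R t"
    and right: "\<And>x. x \<in> {0<..<1} \<Longrightarrow> \<exists>v>x. \<exists>\<alpha> \<beta>. \<forall>t\<in>{x<..<v}. z t = \<alpha> * L t + \<beta> * R t"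
  shows "\<exists>\<alpha> \<beta>. \<forall>x\<in>{0<..<1}. z x = \<alpha> * L x + \<beta> * R x"
proof -
  define a b where "a x = - (z x * deriv R x - deriv z x * R x)"
    and "b x = z x * deriv L x - deriv z x * L x" for x
  have der': "(z has_real_derivative deriv z x) (at x within A)" if "x \<in> {0<..<1}" for x A
    using der[OF that] by (simp add: DERIV_deriv_iff_real_differentiable has_field_derivative_at_within)
  have inner: "a t = \<alpha> \<and> b t = \<beta>"
    if "t \<in> {u<..<v}" "t \<in> {0<..<1}" "\<forall>t\<in>{u<..<v}. z t = \<alpha> * L t + \<beta> * R t" for t u v \<alpha> \<beta>
  proof -
    have "\<forall>\<^sub>F t in at t. z t = \<alpha> * L t + \<beta> * R t"
      using that by (intro eventually_at_in_open'[THEN eventually_mono, of "{u<..<v}"]) auto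
    from combination_coefficients[OF _ that(2) this der'[OF that(2)]] show ?thesis
      by (auto simp: a_def b_def)
  qed
  have loc: "\<forall>\<^sub>F t in nhds x. a t = a x \<and> b t = b x" if x: "x \<in> {0<..<1}" for x
  proof -
    obtain u \<alpha> \<beta> where u: "u < x" "\<forall>t\<in>{u<..<x}. z t = \<alpha> * L t + \<beta> * R t"
      using left[OF x] by blast
    obtain v \<gamma> \<delta> where v: "v > x" "\<forall>t\<in>{x<..<v}. z t = \<gamma> * L t + \<delta> * R t"
      using right[OF x] by blast
    have "\<forall>\<^sub>F t in at_left x. z t = \<alpha> * L t + \<beta> * R t"
      using eventually_at_left_real[OF u(1)] by eventually_elim (use u(2) in blast)
    from combination_coefficients[OF _ x this der'[OF x]] have 1: "a x = \<alpha>" "b x = \<beta>"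
      by (auto simp: a_def b_def)
    have "\<forall>\<^sub>F t in at_right x. z t = \<gamma> * L t + \<delta> * R t"
      using eventually_at_right_real[OF v(1)] by eventually_elim (use v(2) in blast)
    from combination_coefficients[OF _ x this der'[OF x]] have 2: "a x = \<gamma>" "b x = \<delta>"
      by (auto simp: a_def b_def)
    have "a t = a x \<and> b t = b x" if t: "t \<in> {max 0 u<..<min 1 v}" for t
    proof (cases t x rule: linorder_cases)
      case less
      then show ?thesis using inner[of t u x \<alpha> \<beta>] u(2) 1 t by auto
    next
      case greater
      then show ?thesis using inner[of t x v \<gamma> \<delta>] v(2) 2 t by auto
    qed simp
    moreover have "\<forall>\<^sub>F t in nhds x. t \<in> {max 0 u<..<min 1 v}"
      using x u v by (intro eventually_nhds_in_open) auto
    ultimately show ?thesis by (auto elim: eventually_mono)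
  qed
  have const: "f x = f (1/2)"
    if ev: "\<And>x. x \<in> {0<..<1} \<Longrightarrow> \<forall>\<^sub>F t in nhds x. f t = f x" and x: "x \<in> {0<..<1}"
    for f :: "real \<Rightarrow> real" and x
  proof (rule DERIV_isconst3[of 0 1 x "1/2" f])
    show "(f has_real_derivative 0) (at y)" if y: "y \<in> {0<..<1}" for y
      using ev[OF y] DERIV_const[of "f y" "at y"] DERIV_cong_ev[of y y f "\<lambda>_. f y" 0 0] by simp
  qed (use x in auto)
  have "z x = a (1/2) * L x + b (1/2) * R x" if x: "x \<in> {0<..<1}" for x
  proof -
    have "a x = a (1/2)"
      by (rule const[OF _ x], drule loc) (rule eventually_mono, assumption, blast)
    moreover have "b x = b (1/2)"
      by (rule const[OF _ x], drule loc) (rule eventually_mono, assumption, blast)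
    moreover have "a x * L x + b x * R x = - z x * (L x * deriv R x - deriv L x * R x)"
      by (simp add: a_def b_def algebra_simps)
    ultimately show ?thesis using wronskian[OF x] by simp
  qed
  then show ?thesis by blast
qed

text \<open>Point interactions turn into a finite linear system. Subtracting the Green sum from \<open>y\<close> removes all
  jumps of the derivative, so the difference is a global combination of \<open>L\<close> and \<open>R\<close>; the two boundary
  conditions make it vanish.\<close>

lemma dirichlet_solution_eq_green_sum:
  assumes y: "delta_solution q S \<kappa> y" and "finite S" and "y 0 = 0" "y 1 = 0" and "x \<in> {0..1}"
  shows "y x = (\<Sum>s\<in>S \<inter> {0<..<1}. \<kappa> s * y s * G x s)"
proof -
  define T where "T = S \<inter> {0<..<1}"
  have T: "finite T" "T \<subseteq> {0<..<1}" using \<open>finite S\<close> by (auto simp: T_def)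
  define z where "z x = y x - (\<Sum>s\<in>T. \<kappa> s * y s * G x s)" for x
  define K where "K = {0, 1} \<union> S"
  have K: "finite K" "0 \<in> K" "1 \<in> K" using \<open>finite S\<close> by (auto simp: K_def)
  have gap: "\<exists>\<alpha> \<beta>. \<forall>t\<in>{u<..<v}. z t = \<alpha> * L t + \<beta> * R t"
    if uv: "u \<in> K" "v \<in> K" "0 \<le> u" "u < v" "v \<le> 1" "{u<..<v} \<inter> K = {}" for u v
  proof -
    have "{u<..<v} \<inter> S = {}" "{u<..<v} \<inter> T = {}" using uv(6) by (auto simp: K_def T_def)
    note disj = this
    obtain \<alpha> \<beta> where 1: "\<forall>t\<in>{u<..<v}. y t = \<alpha> * L t + \<beta> * R t"
      using combination_on_gap[OF y uv(1,2)[unfolded K_def] uv(3-5) disj(1)] by blast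
    obtain \<gamma> \<delta> where 2: "\<forall>t\<in>{u..v}. (\<Sum>s\<in>T. \<kappa> s * y s * G t s) = \<gamma> * L t + \<delta> * R t"
      using green_sum_combination[OF T(1) disj(2), of "\<lambda>s. \<kappa> s * y s"] by blast
    from 1 2 have "\<forall>t\<in>{u<..<v}. z t = (\<alpha> - \<gamma>) * L t + (\<beta> - \<delta>) * R t"
      by (auto simp: z_def algebra_simps)
    then show ?thesis by blast
  qed
  have diff: "z differentiable (at x)" if x: "x \<in> {0<..<1}" for x
  proof -
    have "\<exists>m p. (y has_real_derivative m) (at_left x) \<and> (y has_real_derivative p) (at_right x) \<and>
        m - p = (if x \<in> T then \<kappa> x * y x else 0)"
    proof (cases "x \<in> S")
      case True
      then have "x \<in> S \<inter> {0<..<1}" using x by blast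
      then obtain m p where "(y has_real_derivative m) (at_left x)" "(y has_real_derivative p) (at_right x)"
        "m - p = \<kappa> x * y x"
        using y unfolding delta_solution_iff by meson
      then show ?thesis using True x by (auto simp: T_def)
    next
      case False
      have "0 < x" "x \<le> 1" using x by auto
      then obtain u v where uv: "u \<in> K" "v \<in> K" "0 \<le> u" "u < x" "x \<le> v" "v \<le> 1" "{u<..<v} \<inter> K = {}"
        using gap_left_of[OF K] by meson
      have "x \<notin> K" using x False by (auto simp: K_def)
      then have xin: "x \<in> {u<..<v}" using uv by (metis greaterThanLessThan_iff le_less)
      have "solves_on q {u<..<v} y"
        using uv xin by (intro delta_solution_imp_solves_on(1)[OF y]) (auto simp: K_def)
      then have "(y has_real_derivative deriv y x) (at x)" using solves_onD(1) xin by blast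
      then have "(y has_real_derivative deriv y x) (at_left x)" "(y has_real_derivative deriv y x) (at_right x)"
        by (blast intro: has_field_derivative_at_within)+
      then show ?thesis using False by (auto simp: T_def)
    qed
    then obtain m p where mp: "(y has_real_derivative m) (at_left x)" "(y has_real_derivative p) (at_right x)"
      "m - p = (if x \<in> T then \<kappa> x * y x else 0)" by blast
    obtain m' p' where mp': "((\<lambda>t. \<Sum>s\<in>T. \<kappa> s * y s * G t s) has_real_derivative m') (at_left x)"
      "((\<lambda>t. \<Sum>s\<in>T. \<kappa> s * y s * G t s) has_real_derivative p') (at_right x)"
      "m' - p' = (if x \<in> T then \<kappa> x * y x else 0)"
      using green_sum_derivatives[OF T x, of "\<lambda>s. \<kappa> s * y s"] by blast
    have "(z has_real_derivative m - m') (at_left x)"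
      unfolding z_def[abs_def] by (rule DERIV_diff[OF mp(1) mp'(1)])
    moreover have "(z has_real_derivative p - p') (at_right x)"
      unfolding z_def[abs_def] by (rule DERIV_diff[OF mp(2) mp'(2)])
    moreover have "p - p' = m - m'" using mp(3) mp'(3) by (simp split: if_splits)
    ultimately have "(z has_real_derivative m - m') (at x)"
      by (intro has_real_derivative_split_at) auto
    then show ?thesis using real_differentiable_def by blast
  qed
  have left: "\<exists>u<x. \<exists>\<alpha> \<beta>. \<forall>t\<in>{u<..<x}. z t = \<alpha> * L t + \<beta> * R t" if x: "x \<in> {0<..<1}" for x
  proof -
    have "0 < x" "x \<le> 1" using x by auto
    then obtain u v where uv: "u \<in> K" "v \<in> K" "0 \<le> u" "u < x" "x \<le> v" "v \<le> 1" "{u<..<v} \<inter> K = {}"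
      using gap_left_of[OF K] by meson
    then obtain \<alpha> \<beta> where "\<forall>t\<in>{u<..<v}. z t = \<alpha> * L t + \<beta> * R t" using gap[of u v] by auto
    then have "\<forall>t\<in>{u<..<x}. z t = \<alpha> * L t + \<beta> * R t" using uv(5) by auto
    then show ?thesis using uv(4) by blast
  qed
  have right: "\<exists>v>x. \<exists>\<alpha> \<beta>. \<forall>t\<in>{x<..<v}. z t = \<alpha> * L t + \<beta> * R t" if x: "x \<in> {0<..<1}" for x
  proof -
    have "0 \<le> x" "x < 1" using x by auto
    then obtain u v where uv: "u \<in> K" "v \<in> K" "0 \<le> u" "u \<le> x" "x < v" "v \<le> 1" "{u<..<v} \<inter> K = {}"
      using gap_right_of[OF K] by meson
    then obtain \<alpha> \<beta> where "\<forall>t\<in>{u<..<v}. z t = \<alpha> * L t + \<beta> * R t" using gap[of u v] by auto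
    then have "\<forall>t\<in>{x<..<v}. z t = \<alpha> * L t + \<beta> * R t" using uv(4) by auto
    then show ?thesis using uv(5) by blast
  qed
  obtain \<alpha> \<beta> where ab: "\<forall>x\<in>{0<..<1}. z x = \<alpha> * L x + \<beta> * R x"
    using global_combination[OF diff left right] by blast
  have cont: "continuous_on {0..1} z"
  proof -
    have ac: "continuous_on {0..1} f" if "abs_cont_on {0..1} f" for f
      by (intro uniformly_continuous_imp_continuous abs_cont_on_imp_uniformly_continuous_on that) simp
    have "abs_cont_on {0..1} y" using y by (simp add: delta_solution_iff)
    moreover have "abs_cont_on {0..1} (\<lambda>x. G x s)" if "s \<in> T" for s
      using that T by (intro abs_cont_green) auto
    ultimately show ?thesis
      unfolding z_def[abs_def] by (intro continuous_intros ac)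
  qed
  have ab01: "z x - (\<alpha> * L x + \<beta> * R x) = 0" if "x \<in> {0..1}" for x
  proof (rule continuous_constant_on_closure[where S = "{0<..<1}" and
        f = "\<lambda>x. z x - (\<alpha> * L x + \<beta> * R x)" and a = 0])
    show "continuous_on (closure {0<..<1}) (\<lambda>x. z x - (\<alpha> * L x + \<beta> * R x))"
      using cont continuous by (auto intro!: continuous_intros)
  qed (use ab that in auto)
  have "z 0 = 0" "z 1 = 0"
    using T(2) boundary assms(3,4) by (auto simp: z_def green_def intro!: sum.neutral)
  then have "\<beta> = 0" "\<alpha> = 0"
    using ab01[of 0] ab01[of 1] boundary nonzero_at_ends by auto
  then show ?thesis using ab01[OF \<open>x \<in> {0..1}\<close>] by (simp add: z_def T_def)
qed

text \<open>Conversely, each solution \<open>\<eta>\<close> of the linear system for the values at the knots extends to a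
  Dirichlet solution.\<close>

lemma green_sum_dirichlet_solution:
  fixes S \<kappa> \<eta>
  defines "y \<equiv> \<lambda>x. \<Sum>s\<in>S \<inter> {0<..<1}. \<kappa> s * \<eta> s * G x s"
  assumes "finite S" and \<eta>: "\<And>s. s \<in> S \<inter> {0<..<1} \<Longrightarrow> y s = \<eta> s"
  shows "delta_solution q S \<kappa> y" "y 0 = 0" "y 1 = 0"
proof -
  define T where "T = S \<inter> {0<..<1}"
  have T: "finite T" "T \<subseteq> {0<..<1}" using \<open>finite S\<close> by (auto simp: T_def)
  define K where "K = {0, 1} \<union> S"
  have K: "finite K" "0 \<in> K" "1 \<in> K" using \<open>finite S\<close> by (auto simp: K_def)
  show "y 0 = 0" "y 1 = 0"
    using boundary by (auto simp: y_def green_def intro!: sum.neutral)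
  have gap: "\<exists>\<alpha> \<beta>. \<forall>t\<in>{u..v}. y t = \<alpha> * L t + \<beta> * R t" if "{u<..<v} \<inter> S = {}" for u v
  proof -
    have "{u<..<v} \<inter> T = {}" using that by (auto simp: T_def)
    from green_sum_combination[OF T(1) this, of "\<lambda>s. \<kappa> s * \<eta> s"] show ?thesis
      by (simp add: y_def T_def)
  qed
  have sol: "solves_on q {u<..<v} y" if uv: "0 \<le> u" "v \<le> 1" "{u<..<v} \<inter> S = {}" for u v
  proof -
    obtain \<alpha> \<beta> where "\<forall>t\<in>{u..v}. y t = \<alpha> * L t + \<beta> * R t" using gap[OF uv(3)] by blast
    then have eq: "y t = \<alpha> * L t + \<beta> * R t" if "t \<in> {u<..<v}" for t using that by auto
    have sub: "{u<..<v} \<subseteq> {0<..<1}" using uv by auto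
    show ?thesis
      by (rule solves_on_of_combination[OF solves_on_subset[OF solves(1) sub] solves_on_subset[OF solves(2) sub] eq])
  qed
  have onesided: "y differentiable (at x within {u..v})"
    if uv: "0 \<le> u" "v \<le> 1" "{u<..<v} \<inter> S = {}" and x: "x \<in> {u..v}" for x u v
  proof -
    obtain \<alpha> \<beta> where eq: "\<forall>t\<in>{u..v}. y t = \<alpha> * L t + \<beta> * R t" using gap[OF uv(3)] by blast
    have sub: "{u..v} \<subseteq> {0..1}" using uv by auto
    then have "x \<in> {0..1}" using x by blast
    then have "((\<lambda>t. \<alpha> * L t + \<beta> * R t) has_real_derivative \<alpha> * deriv01 L x + \<beta> * deriv01 R x) (at x within {u..v})"
      using has_derivative01[of x] by (auto intro!: derivative_eq_intros intro: has_field_derivative_subset[OF _ sub])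
    then have "(y has_real_derivative \<alpha> * deriv01 L x + \<beta> * deriv01 R x) (at x within {u..v})"
      by (rule has_field_derivative_transform_within[OF _ zero_less_one x]) (use eq in auto)
    then show ?thesis using real_differentiable_def by blast
  qed
  show "delta_solution q S \<kappa> y"
    unfolding delta_solution_iff
  proof (intro conjI ballI impI)
    have "abs_cont_on {0..1} (\<lambda>x. \<Sum>s\<in>T. c s * G x s)" for c
      using T
    proof (induction T rule: finite_induct)
      case empty
      show ?case using abs_cont_on_linear_combination[OF abs_cont_on_id abs_cont_on_id, of _ 0 0] by simp
    next
      case (insert s T)
      have "s \<in> {0..1}" using insert.prems by auto
      then have "abs_cont_on {0..1} (\<lambda>x. c s * G x s + 1 * (\<Sum>s\<in>T. c s * G x s))"
        using insert by (intro abs_cont_on_linear_combination abs_cont_green) auto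
      then show ?case using insert.hyps by simp
    qed
    then show "abs_cont_on {0..1} y" by (simp add: y_def T_def)
  next
    fix u v x
    assume uv: "0 \<le> u \<and> u < v \<and> v \<le> 1 \<and> {u<..<v} \<inter> S = {}"
    show "x \<in> {u<..<v} \<Longrightarrow> y differentiable (at x)" "abs_cont_on {u<..<v} (deriv y)"
      using sol[of u v] uv by (auto simp: solves_on_def)
    show "y differentiable (at_right u)" "y differentiable (at_left v)"
      using onesided[of u v u] onesided[of u v v] uv
      by (auto simp: at_within_Icc_at_right at_within_Icc_at_left)
  next
    define P where "P = {(u, v) \<in> K \<times> K. 0 \<le> u \<and> v \<le> 1 \<and> {u<..<v} \<inter> S = {}}"
    have "finite P" unfolding P_def by (rule finite_subset[of _ "K \<times> K"]) (use K in auto)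
    have "AE x in lebesgue. \<forall>w\<in>P. x \<in> {fst w<..<snd w} \<longrightarrow> (deriv y has_real_derivative q x * y x) (at x)"
      using solves_onD(3)[OF sol] by (intro AE_finite_allI[OF \<open>finite P\<close>]) (auto simp: P_def)
    then show "AE x in lebesgue. x \<in> {0<..<1} - S \<longrightarrow> (deriv y has_real_derivative q x * y x) (at x)"
    proof eventually_elim
      case (elim x)
      show ?case
      proof
        assume x: "x \<in> {0<..<1} - S"
        then have "0 < x" "x \<le> 1" by auto
        then obtain u v where uv: "u \<in> K" "v \<in> K" "0 \<le> u" "u < x" "x \<le> v" "v \<le> 1" "{u<..<v} \<inter> K = {}"
          using gap_left_of[OF K] by meson
        have "x \<notin> K" using x by (auto simp: K_def)
        then have "x < v" using uv by (metis le_less)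
        moreover have "(u, v) \<in> P" using uv by (auto simp: P_def K_def)
        ultimately show "(deriv y has_real_derivative q x * y x) (at x)" using elim uv by fastforce
      qed
    qed
  next
    fix s assume s: "s \<in> S \<inter> {0<..<1}"
    then have "s \<in> T" "s \<in> {0<..<1}" by (auto simp: T_def)
    with green_sum_derivatives[OF T \<open>s \<in> {0<..<1}\<close>, of "\<lambda>s. \<kappa> s * \<eta> s"] \<eta>[OF s]
    show "\<exists>m p. (y has_real_derivative m) (at_left s) \<and> (y has_real_derivative p) (at_right s) \<and>
              m - p = \<kappa> s * y s"
      by (simp add: y_def T_def)
  qed
qed

end

section \<open>Eigenvalues with point interactions\<close>

lemma ereal_less_reciprocalD:
  assumes "0 < r" "ereal r < 1 / ereal D"
  shows "0 \<le> D" "r * D < 1"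
proof -
  have "0 \<le> D \<and> r * D < 1"
  proof (cases "D = 0")
    case False
    then have "r < 1 / D" using assms(2) by (simp add: one_ereal_def)
    moreover from this have "D > 0" using \<open>0 < r\<close> by (metis False divide_less_0_1_iff less_asym' linorder_neqE_linordered_idom order.strict_trans)
    ultimately show ?thesis by (simp add: field_simps)
  qed simp
  then show "0 \<le> D" "r * D < 1" by auto
qed

text \<open>A positive number can only be smaller than \<open>1 / D\<close> (with \<open>1 / 0 = \<infinity>\<close>) if \<open>D\<close> is nonnegative. So
  the bound on \<open>r\<close> also carries the sign of the two denominators.\<close>

lemma r_boundD:
  assumes "0 < r" "ereal r < r_bound a L R"
  shows "t \<in> {0<..a} \<Longrightarrow> 0 \<le> (R t - R a / L a * L t) * L t"
    and "t \<in> {0<..a} \<Longrightarrow> r * ((R t - R a / L a * L t) * L t) < 1"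
    and "t \<in> {a..<1} \<Longrightarrow> 0 \<le> (L t - L a / R a * R t) * R t"
    and "t \<in> {a..<1} \<Longrightarrow> r * ((L t - L a / R a * R t) * R t) < 1"
proof -
  have "ereal r < (INF t\<in>{0<..a}. 1 / ereal ((R t - R a / L a * L t) * L t))"
    and "ereal r < (INF t\<in>{a..<1}. 1 / ereal ((L t - L a / R a * R t) * R t))"
    using assms(2) unfolding r_bound_def by auto
  then have 1: "t \<in> {0<..a} \<Longrightarrow> ereal r < 1 / ereal ((R t - R a / L a * L t) * L t)"
    and 2: "t \<in> {a..<1} \<Longrightarrow> ereal r < 1 / ereal ((L t - L a / R a * R t) * R t)" for t
    by (meson INF_lower order.strict_trans2)+
  show "t \<in> {0<..a} \<Longrightarrow> 0 \<le> (R t - R a / L a * L t) * L t"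
    "t \<in> {0<..a} \<Longrightarrow> r * ((R t - R a / L a * L t) * L t) < 1"
    using ereal_less_reciprocalD[OF assms(1) 1] by blast+
  show "t \<in> {a..<1} \<Longrightarrow> 0 \<le> (L t - L a / R a * R t) * R t"
    "t \<in> {a..<1} \<Longrightarrow> r * ((L t - L a / R a * R t) * R t) < 1"
    using ereal_less_reciprocalD[OF assms(1) 2] by blast+
qed

context wronskian_pair begin

text \<open>At a zero \<open>c\<close> of \<open>L\<close> the function \<open>(R - k L) L\<close> vanishes and has the derivative
  \<open>R(c) L'(c) = -W[L,R](c) = 1\<close>. It is thus negative just to the left of \<open>c\<close>. Hence \<open>L\<close> cannot vanish,
  and it is positive near \<open>0\<close>.\<close>

lemma L_pos_left:
  assumes "0 < a" "a < 1" and D: "\<And>t. t \<in> {0<..a} \<Longrightarrow> 0 \<le> (R t - k * L t) * L t"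
    and x: "x \<in> {0<..a}"
  shows "L x > 0"
proof -
  have nz: "L c \<noteq> 0" if c: "c \<in> {0<..a}" for c
  proof
    assume "L c = 0"
    have c': "c \<in> {0<..<1}" using c assms by auto
    have "((\<lambda>t. (R t - k * L t) * L t) has_real_derivative
        (deriv R c - k * deriv L c) * L c + deriv L c * (R c - k * L c)) (at c)"
      by (intro DERIV_mult DERIV_diff DERIV_cmult has_derivative c')
    moreover have "(deriv R c - k * deriv L c) * L c + deriv L c * (R c - k * L c) = 1"
      using wronskian[OF c'] \<open>L c = 0\<close> by simp
    ultimately obtain d where d: "d > 0"
      "\<And>h. 0 < h \<Longrightarrow> h < d \<Longrightarrow> (R (c - h) - k * L (c - h)) * L (c - h) < (R c - k * L c) * L c"
      using DERIV_pos_inc_left[of "\<lambda>t. (R t - k * L t) * L t" 1 c] by auto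
    define h where "h = min (d / 2) (c / 2)"
    have "0 < h" "h < d" "c - h \<in> {0<..a}" using d(1) c by (auto simp: h_def min_def)
    then show False using d(2)[of h] D[of "c - h"] \<open>L c = 0\<close> by simp
  qed
  obtain d where d: "d > 0" "\<And>h. 0 < h \<Longrightarrow> h \<in> {0..1} \<Longrightarrow> h < d \<Longrightarrow> L 0 < L h"
    using has_real_derivative_pos_inc_right[OF has_derivative01(1)[of 0] boundary(3)] by auto
  define h where "h = min (d / 2) (x / 2)"
  have h: "0 < h" "h < d" "h < x" using d(1) x by (auto simp: h_def min_def)
  then have "L h > 0" using d(2)[of h] x assms boundary by auto
  show ?thesis
  proof (rule ccontr)
    assume "\<not> L x > 0"
    then have "\<exists>c\<ge>h. c \<le> x \<and> L c = 0"
      using \<open>L h > 0\<close> h x assms by (intro IVT2' continuous_on_subset[OF continuous(1)]) auto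
    then obtain c where "h \<le> c" "c \<le> x" "L c = 0" by blast
    then show False using nz[of c] h x by auto
  qed
qed

text \<open>Mirror image of the previous argument; now the derivative at a zero of \<open>R\<close> is \<open>-1\<close>.\<close>

lemma R_pos_right:
  assumes "0 < a" "a < 1" and D: "\<And>t. t \<in> {a..<1} \<Longrightarrow> 0 \<le> (L t - k * R t) * R t"
    and x: "x \<in> {a..<1}"
  shows "R x > 0"
proof -
  have nz: "R c \<noteq> 0" if c: "c \<in> {a..<1}" for c
  proof
    assume "R c = 0"
    have c': "c \<in> {0<..<1}" using c assms by auto
    have "((\<lambda>t. (L t - k * R t) * R t) has_real_derivative
        (deriv L c - k * deriv R c) * R c + deriv R c * (L c - k * R c)) (at c)"
      by (intro DERIV_mult DERIV_diff DERIV_cmult has_derivative c')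
    moreover have "(deriv L c - k * deriv R c) * R c + deriv R c * (L c - k * R c) = -1"
      using wronskian[OF c'] \<open>R c = 0\<close> by (simp add: mult.commute)
    ultimately obtain d where d: "d > 0"
      "\<And>h. 0 < h \<Longrightarrow> h < d \<Longrightarrow> (L (c + h) - k * R (c + h)) * R (c + h) < (L c - k * R c) * R c"
      using DERIV_neg_dec_right[of "\<lambda>t. (L t - k * R t) * R t" "-1" c] by auto
    define h where "h = min (d / 2) ((1 - c) / 2)"
    have "0 < h" "h < d" "h \<le> (1 - c) / 2" using d(1) c by (auto simp: h_def min_def)
    moreover from this have "c + h \<in> {a..<1}" using c by auto
    ultimately show False using d(2)[of h] D[of "c + h"] \<open>R c = 0\<close> by simp
  qed
  obtain d where d: "d > 0" "\<And>h. 0 < h \<Longrightarrow> 1 - h \<in> {0..1} \<Longrightarrow> h < d \<Longrightarrow> R 1 < R (1 - h)"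
    using has_real_derivative_neg_dec_left[OF has_derivative01(2)[of 1] boundary(4)] by auto
  define h where "h = min (d / 2) ((1 - x) / 2)"
  have h: "0 < h" "h < d" "h < 1 - x" using d(1) x by (auto simp: h_def min_def)
  then have "R (1 - h) > 0" using d(2)[of h] x assms boundary by auto
  show ?thesis
  proof (rule ccontr)
    assume "\<not> R x > 0"
    then have "\<exists>c\<ge>x. c \<le> 1 - h \<and> R c = 0"
      using \<open>R (1 - h) > 0\<close> h x assms by (intro IVT' continuous_on_subset[OF continuous(2)]) auto
    then obtain c where "x \<le> c" "c \<le> 1 - h" "R c = 0" by blast
    then show False using nz[of c] h x by auto
  qed
qed

text \<open>On the half of the interval adjacent to its boundary zero each function is positive by the previous
  lemmas. On the other half \<open>R \<ge> (R(a)/L(a)) L\<close> or \<open>L \<ge> (L(a)/R(a)) R\<close>, by the sign of the denominators.\<close>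

lemma solutions_pos:
  assumes a: "0 < a" "a < 1" and r: "0 < r" "ereal r < r_bound a L R" and x: "x \<in> {0<..<1}"
  shows "L x > 0" "R x > 0"
proof -
  note D = r_boundD[OF r]
  have L: "L t > 0" if "t \<in> {0<..a}" for t using L_pos_left[OF a D(1) that] .
  have R: "R t > 0" if "t \<in> {a..<1}" for t using R_pos_right[OF a D(3) that] .
  have aa: "L a > 0" "R a > 0" using L[of a] R[of a] a by auto
  have "L x > 0 \<and> R x > 0"
  proof (cases "x \<le> a")
    case True
    then have x': "x \<in> {0<..a}" using x by auto
    have "R a / L a * L x > 0" using aa L[OF x'] by simp
    moreover have "R x - R a / L a * L x \<ge> 0"
      using D(1)[OF x'] L[OF x'] by (simp add: zero_le_mult_iff)
    ultimately show ?thesis using L[OF x'] by linarith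
  next
    case False
    then have x': "x \<in> {a..<1}" using x by auto
    have "L a / R a * R x > 0" using aa R[OF x'] by simp
    moreover have "L x - L a / R a * R x \<ge> 0"
      using D(3)[OF x'] R[OF x'] by (simp add: zero_le_mult_iff)
    ultimately show ?thesis using R[OF x'] by linarith
  qed
  then show "L x > 0" "R x > 0" by auto
qed

lemma green_at_ends: "x \<in> {0..1} \<Longrightarrow> G x 0 = 0" "x \<in> {0..1} \<Longrightarrow> G x 1 = 0"
  using boundary by (auto simp: green_def max_def min_def)

text \<open>Since \<open>G\<close> vanishes on the boundary and the two strengths add up at a common knot, the cases
  \<open>t = 0\<close>, \<open>t = 1\<close> and \<open>t = a\<close> need no separate treatment afterwards.\<close>

lemma green_sum_pair:
  assumes "0 < a" "a < 1" "t \<in> {0..1}" "x \<in> {0..1}"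
  shows "(\<Sum>s\<in>{a, t} \<inter> {0<..<1}. ((if s = a then m else 0) + (if s = t then r else 0)) * y s * G x s)
    = m * y a * G x a + r * y t * G x t"
proof (cases "t \<in> {0, 1}")
  case True
  then have "{a, t} \<inter> {0<..<1} = {a}" "t \<noteq> a" "G x t = 0" using assms green_at_ends[of x] by auto
  then show ?thesis by simp
next
  case False
  then have "{a, t} \<inter> {0<..<1} = {a, t}" using assms by auto
  then show ?thesis by (cases "t = a") (auto simp: algebra_simps)
qed

text \<open>The values at \<open>a\<close> and \<open>t\<close> satisfy the system
  \<open>y(a) = \<mu> w\<^sub>0 G(a,a) y(a) + r G(a,t) y(t)\<close>, \<open>N y(t) = \<mu> w\<^sub>0 G(a,t) y(a)\<close>. Eliminating \<open>y(t)\<close> leaves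
  \<open>N y(a) = \<mu> w\<^sub>0 M y(a)\<close>, and \<open>y(a) = 0\<close> would force \<open>y = 0\<close>. For the eigenvalue so found, the null vector is
  \<open>(M, G(a,t))\<close>; unlike \<open>(N, \<mu> w\<^sub>0 G(a,t))\<close> it does not degenerate for \<open>\<mu> = 0\<close>.\<close>

lemma eigenvalue_P1t_iff:
  fixes r :: real
  assumes a: "0 < a" "a < 1" and "w0 > 0" "t \<in> {0..1}"
  defines "N \<equiv> 1 - r * G t t" and "M \<equiv> G a a * (1 - r * G t t) + r * (G a t)\<^sup>2"
  assumes "M > 0"
  shows "eigenvalue_P1t q a w0 r t \<mu> \<longleftrightarrow> \<mu> = N / (w0 * M)"
proof
  define \<kappa> where "\<kappa> s = (if s = a then \<mu> * w0 else 0) + (if s = t then r else 0)" for s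
  have a01: "a \<in> {0..1}" using a by auto
  {
    assume "eigenvalue_P1t q a w0 r t \<mu>"
    then obtain y where y: "delta_solution q {a, t} \<kappa> y" "y 0 = 0" "y 1 = 0" "\<exists>x\<in>{0..1}. y x \<noteq> 0"
      by (auto simp: eigenvalue_P1t_def dirichlet_nontrivial_def \<kappa>_def[abs_def])
    have rep: "y x = \<mu> * w0 * y a * G x a + r * y t * G x t" if "x \<in> {0..1}" for x
      using dirichlet_solution_eq_green_sum[OF y(1) _ y(2,3) that]
        green_sum_pair[OF a assms(4) that, of "\<mu> * w0" r y]
      by (simp add: \<kappa>_def)
    have eqa: "y a = \<mu> * w0 * y a * G a a + r * y t * G a t" by (rule rep[OF a01])
    have eqt: "N * y t = \<mu> * w0 * y a * G a t"
      using rep[OF assms(4)] by (simp add: N_def green_commute[of L R t a] algebra_simps)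
    have "y a \<noteq> 0"
    proof
      assume 0: "y a = 0"
      have "y t \<noteq> 0"
      proof
        assume "y t = 0"
        then have "\<forall>x\<in>{0..1}. y x = 0" using rep 0 by simp
        then show False using y(4) by blast
      qed
      then have "N = 0" "r * G a t = 0" using eqt eqa 0 by auto
      then have "M = 0" by (auto simp: M_def N_def power2_eq_square)
      with \<open>M > 0\<close> show False by simp
    qed
    have "N * y a = \<mu> * w0 * y a * G a a * N + r * G a t * (N * y t)"
      by (subst eqa) (simp add: algebra_simps)
    also have "\<dots> = (\<mu> * w0 * M) * y a"
      by (simp add: eqt M_def N_def[symmetric] algebra_simps power2_eq_square)
    finally have "N = \<mu> * w0 * M" using \<open>y a \<noteq> 0\<close> by simp
    then show "\<mu> = N / (w0 * M)" using \<open>w0 > 0\<close> \<open>M > 0\<close> by (simp add: field_simps)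
  next
    assume "\<mu> = N / (w0 * M)"
    then have N: "\<mu> * w0 * M = N" using \<open>w0 > 0\<close> \<open>M > 0\<close> by simp
    \<comment> \<open>For \<open>t = a\<close> the two prescribed values agree, as then \<open>M = G(a,a)\<close>.\<close>
    define \<eta> where "\<eta> s = (if s = a then M else G a t)" for s
    have \<eta>: "\<eta> a = M" "\<eta> t = G a t"
      by (auto simp: \<eta>_def M_def power2_eq_square algebra_simps)
    define y where "y x = (\<Sum>s\<in>{a, t} \<inter> {0<..<1}. \<kappa> s * \<eta> s * G x s)" for x
    have rep: "y x = N * G x a + r * G a t * G x t" if "x \<in> {0..1}" for x
      using green_sum_pair[OF a assms(4) that, of "\<mu> * w0" r \<eta>]
      by (simp add: y_def \<kappa>_def \<eta> N)
    have ya: "y a = \<eta> a"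
      using rep[OF a01] by (simp add: \<eta> M_def N_def power2_eq_square algebra_simps)
    have yt: "y t = \<eta> t"
      using rep[OF assms(4)] by (simp add: \<eta> N_def green_commute[of L R t a] algebra_simps)
    have "delta_solution q {a, t} \<kappa> y" "y 0 = 0" "y 1 = 0"
      unfolding y_def using ya yt by (intro green_sum_dirichlet_solution; auto simp: y_def)+
    moreover have "\<exists>x\<in>{0..1}. y x \<noteq> 0"
      using a01 ya \<open>M > 0\<close> by (auto simp: \<eta> intro!: bexI[of _ a])
    ultimately show "eigenvalue_P1t q a w0 r t \<mu>"
      unfolding eigenvalue_P1t_def dirichlet_nontrivial_def \<kappa>_def[abs_def] by blast
  }
qed

lemma eigenvalue_P1_iff:
  assumes a: "0 < a" "a < 1" and "w0 > 0" "G a a > 0"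
  shows "eigenvalue_P1 q a w0 \<mu> \<longleftrightarrow> \<mu> = 1 / (w0 * G a a)"
proof
  have a01: "a \<in> {0..1}" and S: "{a} \<inter> {0<..<1} = {a}" using a by auto
  {
    assume "eigenvalue_P1 q a w0 \<mu>"
    then obtain y where y: "delta_solution q {a} (\<lambda>_. \<mu> * w0) y" "y 0 = 0" "y 1 = 0" "\<exists>x\<in>{0..1}. y x \<noteq> 0"
      by (auto simp: eigenvalue_P1_def dirichlet_nontrivial_def)
    have rep: "y x = \<mu> * w0 * y a * G x a" if "x \<in> {0..1}" for x
      using dirichlet_solution_eq_green_sum[OF y(1) _ y(2,3) that] S by simp
    then have "y a \<noteq> 0" using y(4) by force
    with rep[OF a01] have "\<mu> * w0 * G a a = 1" by simp
    then show "\<mu> = 1 / (w0 * G a a)" using assms(3,4) by (simp add: field_simps)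
  next
    assume "\<mu> = 1 / (w0 * G a a)"
    then have \<mu>: "\<mu> * w0 = 1 / G a a" using \<open>w0 > 0\<close> by simp
    define y where "y x = (\<Sum>s\<in>{a} \<inter> {0<..<1}. (\<mu> * w0) * 1 * G x s)" for x
    have ya: "y a = 1" using S \<mu> \<open>G a a > 0\<close> by (simp add: y_def)
    have "delta_solution q {a} (\<lambda>_. \<mu> * w0) y" "y 0 = 0" "y 1 = 0"
      unfolding y_def using ya by (intro green_sum_dirichlet_solution; simp add: y_def)+
    moreover have "\<exists>x\<in>{0..1}. y x \<noteq> 0" using ya a01 by force
    ultimately show "eigenvalue_P1 q a w0 \<mu>"
      unfolding eigenvalue_P1_def dirichlet_nontrivial_def by blast
  }
qed

lemma unperturbed_eigenvalue_eq:
  assumes "0 < a" "a < 1" "w0 > 0" "G a a > 0"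
  shows "unperturbed_eigenvalue q a w0 = 1 / (w0 * G a a)"
  unfolding unperturbed_eigenvalue_def eigenvalue_P1_iff[OF assms] by simp

text \<open>The problem has a single eigenvalue as soon as \<open>M > 0\<close>, and \<open>M\<close> is \<open>L(a) R(a) (1 - r D)\<close>, where
  \<open>1 / D\<close> is the quotient in the bound on \<open>r\<close>.\<close>

lemma first_eigenvalue_eq:
  assumes a: "0 < a" "a < 1" and r: "0 < r" "ereal r < r_bound a L R" and "w0 > 0" and t: "t \<in> {0..1}"
  defines "M \<equiv> G a a * (1 - r * G t t) + r * (G a t)\<^sup>2"
  shows "M > 0" "first_eigenvalue q a w0 r t = (1 - r * G t t) / (w0 * M)"
proof -
  have pa: "L a > 0" "R a > 0" using solutions_pos[OF a r, of a] a by auto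
  note D = r_boundD[OF r]
  show "M > 0"
  proof (cases "t \<in> {0, 1}")
    case True
    then have "M = L a * R a" using green_at_ends[of t] green_at_ends[of a] a
      by (auto simp: M_def green_def)
    then show ?thesis using pa by simp
  next
    case False
    show ?thesis
    proof (cases "t \<le> a")
      case True
      have "M = L a * R a * (1 - r * ((R t - R a / L a * L t) * L t))"
        using True pa by (simp add: M_def green_def field_simps power2_eq_square)
      also have "\<dots> > 0" using pa D(2)[of t] False True t by (intro mult_pos_pos) auto
      finally show ?thesis .
    next
      case nle: False
      have "M = L a * R a * (1 - r * ((L t - L a / R a * R t) * R t))"
        using nle pa by (simp add: M_def green_def field_simps power2_eq_square)
      also have "\<dots> > 0" using pa D(4)[of t] False nle t by (intro mult_pos_pos) auto
      finally show ?thesis .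
    qed
  qed
  then show "first_eigenvalue q a w0 r t = (1 - r * G t t) / (w0 * M)"
    using eigenvalue_P1t_iff[OF a \<open>w0 > 0\<close> t, of r]
    unfolding first_eigenvalue_def M_def[symmetric] by (intro Least_equality) auto
qed

lemma first_eigenvalue_ends:
  assumes a: "0 < a" "a < 1" and r: "0 < r" "ereal r < r_bound a L R" and "w0 > 0" and t: "t \<in> {0, 1}"
  shows "first_eigenvalue q a w0 r t = unperturbed_eigenvalue q a w0"
proof -
  have "G t t = 0" "G a t = 0" "t \<in> {0..1}" using t green_at_ends[of t] green_at_ends[of a] a by auto
  moreover have "G a a > 0" using solutions_pos[OF a r, of a] a by (auto simp: green_def)
  ultimately show ?thesis
    using first_eigenvalue_eq(2)[OF a r \<open>w0 > 0\<close>, of t] unperturbed_eigenvalue_eq[OF a \<open>w0 > 0\<close>] by simp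
qed

text \<open>With \<open>\<mu> = N / (w\<^sub>0 M)\<close> and \<open>\<lambda>\<^sub>1 = 1 / (w\<^sub>0 G(a,a))\<close>, the difference \<open>\<lambda>\<^sub>1 - \<mu>\<close> only retains the term
  \<open>r G(a,t)\<^sup>2\<close> of \<open>M\<close>.\<close>

lemma eigenvalue_quotient:
  assumes a: "0 < a" "a < 1" and r: "0 < r" "ereal r < r_bound a L R" and "w0 > 0" and t: "t \<in> {0<..<1}"
  defines "\<mu> \<equiv> first_eigenvalue q a w0 r t"
  shows "\<mu> / (unperturbed_eigenvalue q a w0 - \<mu>) = G a a * (1 - r * G t t) / (r * (G a t)\<^sup>2)"
proof -
  define N M where "N = 1 - r * G t t" and "M = G a a * N + r * (G a t)\<^sup>2"
  have t01: "t \<in> {0..1}" using t by auto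
  have M: "M > 0" and \<mu>: "\<mu> = N / (w0 * M)"
    using first_eigenvalue_eq[OF a r \<open>w0 > 0\<close> t01] by (simp_all add: N_def M_def \<mu>_def)
  have Gaa: "G a a > 0" using solutions_pos[OF a r, of a] a by (auto simp: green_def)
  have "G a t > 0" using solutions_pos[OF a r] a t by (auto simp: green_def min_def max_def)
  then have g: "r * (G a t)\<^sup>2 > 0" using r(1) by simp
  have diff: "unperturbed_eigenvalue q a w0 - \<mu> = (r * (G a t)\<^sup>2) / (w0 * G a a * M)"
    unfolding unperturbed_eigenvalue_eq[OF a \<open>w0 > 0\<close> Gaa] \<mu>
    using Gaa M \<open>w0 > 0\<close> by (simp add: field_simps) (simp add: M_def algebra_simps)
  then show ?thesis
    unfolding diff unfolding \<mu> N_def[symmetric] using Gaa M \<open>w0 > 0\<close> by simp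
qed

end

section \<open>Reconstruction of the potential\<close>

text \<open>The linear equation \<open>Z' + r Z = - r \<rho>\<close> with \<open>Z(a) = 1\<close>, solved by the integrating factor
  \<open>exp (r s)\<close>.\<close>

lemma inversion_left:
  fixes Z Z' \<rho> :: "real \<Rightarrow> real"
  assumes "t \<le> a" "Z a = 1"
    and Z: "\<And>s. s \<in> {t..a} \<Longrightarrow> (Z has_real_derivative Z' s) (at s)"
    and \<rho>: "\<And>s. s \<in> {t..a} \<Longrightarrow> r * \<rho> s = - Z' s - r * Z s"
  shows "exp (r * (a - t)) + r * integral {t..a} (\<lambda>s. \<rho> s * exp (r * (s - t))) = Z t"
proof -
  define F where "F s = Z s * exp (r * (s - t))" for s
  have "(F has_vector_derivative - r * (\<rho> s * exp (r * (s - t)))) (at s within {t..a})"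
    if s: "s \<in> {t..a}" for s
  proof -
    have "(F has_real_derivative Z' s * exp (r * (s - t)) + Z s * (exp (r * (s - t)) * r)) (at s)"
      unfolding F_def[abs_def] by (auto intro!: derivative_eq_intros Z[OF s])
    moreover have "Z' s * exp (r * (s - t)) + Z s * (exp (r * (s - t)) * r)
        = - (- Z' s - r * Z s) * exp (r * (s - t))"
      by (simp add: algebra_simps)
    then have "Z' s * exp (r * (s - t)) + Z s * (exp (r * (s - t)) * r) = - r * (\<rho> s * exp (r * (s - t)))"
      unfolding \<rho>[OF s, symmetric] by simp
    ultimately show ?thesis
      by (simp add: has_real_derivative_iff_has_vector_derivative has_vector_derivative_at_within)
  qed
  then have "((\<lambda>s. - r * (\<rho> s * exp (r * (s - t)))) has_integral F a - F t) {t..a}"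
    by (rule fundamental_theorem_of_calculus[OF \<open>t \<le> a\<close>])
  then have "F a - F t = integral {t..a} (\<lambda>s. - r * (\<rho> s * exp (r * (s - t))))"
    by (rule integral_unique[symmetric])
  also have "\<dots> = - r * integral {t..a} (\<lambda>s. \<rho> s * exp (r * (s - t)))"
    by (rule integral_mult_right)
  finally show ?thesis using \<open>Z a = 1\<close> by (simp add: F_def)
qed

lemma inversion_right:
  fixes Z Z' \<rho> :: "real \<Rightarrow> real"
  assumes "a \<le> t" "Z a = 1"
    and Z: "\<And>s. s \<in> {a..t} \<Longrightarrow> (Z has_real_derivative Z' s) (at s)"
    and \<rho>: "\<And>s. s \<in> {a..t} \<Longrightarrow> r * \<rho> s = Z' s - r * Z s"
  shows "exp (r * (t - a)) + r * integral {a..t} (\<lambda>s. \<rho> s * exp (r * (t - s))) = Z t"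
proof -
  define F where "F s = Z s * exp (r * (t - s))" for s
  have "(F has_vector_derivative r * (\<rho> s * exp (r * (t - s)))) (at s within {a..t})"
    if s: "s \<in> {a..t}" for s
  proof -
    have "(F has_real_derivative Z' s * exp (r * (t - s)) + Z s * (exp (r * (t - s)) * (- r))) (at s)"
      unfolding F_def[abs_def] by (auto intro!: derivative_eq_intros Z[OF s])
    moreover have "Z' s * exp (r * (t - s)) + Z s * (exp (r * (t - s)) * (- r))
        = (Z' s - r * Z s) * exp (r * (t - s))"
      by (simp add: algebra_simps)
    then have "Z' s * exp (r * (t - s)) + Z s * (exp (r * (t - s)) * (- r)) = r * (\<rho> s * exp (r * (t - s)))"
      unfolding \<rho>[OF s, symmetric] by simp
    ultimately show ?thesis
      by (simp add: has_real_derivative_iff_has_vector_derivative has_vector_derivative_at_within)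
  qed
  then have "((\<lambda>s. r * (\<rho> s * exp (r * (t - s)))) has_integral F t - F a) {a..t}"
    by (rule fundamental_theorem_of_calculus[OF \<open>a \<le> t\<close>])
  then have "F t - F a = integral {a..t} (\<lambda>s. r * (\<rho> s * exp (r * (t - s))))"
    by (rule integral_unique[symmetric])
  also have "\<dots> = r * integral {a..t} (\<lambda>s. \<rho> s * exp (r * (t - s)))"
    by (rule integral_mult_right)
  finally show ?thesis using \<open>Z a = 1\<close> by (simp add: F_def)
qed

lemma inverse_square_powr: "0 < x \<Longrightarrow> (1 / x\<^sup>2) powr (- 1 / 2) = (x :: real)"
  by (simp add: powr_minus_divide powr_divide powr_half_sqrt)

context wronskian_pair begin

text \<open>For \<open>L(a) = R(a)\<close> and \<open>s \<le> a\<close> the eigenvalue quotient is \<open>\<rho> = 1 / (r L\<^sup>2) - R / L\<close>. Since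
  \<open>Z = R / L\<close> has \<open>Z' = - 1 / L\<^sup>2\<close>, this is the equation \<open>Z' + r Z = - r \<rho>\<close>, and the bracket in the formula
  for \<open>R\<close> is its solution \<open>Z\<close>. Finally \<open>r (Z + \<rho>) / Z\<^sup>2 = (1 / L\<^sup>2) / (R / L)\<^sup>2 = 1 / R\<^sup>2\<close>.\<close>

lemma R_reconstruction:
  assumes a: "0 < a" "a < 1" and r: "0 < r" "ereal r < r_bound a L R" and "w0 > 0"
    and eq: "L a = R a" and t: "t \<in> {0<..a}"
    and lam: "\<And>t. t \<in> {0..1} \<Longrightarrow> lam t = first_eigenvalue q a w0 r t"
  shows "R_formula a r lam (unperturbed_eigenvalue q a w0) t = R t"
proof -
  define \<rho> where "\<rho> s = lam s / (unperturbed_eigenvalue q a w0 - lam s)" for s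
  have in01: "s \<in> {0<..<1}" if "s \<in> {t..a}" for s using that t a by auto
  have \<rho>: "r * \<rho> s = 1 / (L s)\<^sup>2 - r * (R s / L s)" if s: "s \<in> {t..a}" for s
  proof -
    have p: "L s > 0" "R s > 0" "R a > 0" using solutions_pos[OF a r in01[OF s]] solutions_pos[OF a r, of a] a by auto
    have "\<rho> s = G a a * (1 - r * G s s) / (r * (G a s)\<^sup>2)"
      using eigenvalue_quotient[OF a r \<open>w0 > 0\<close> in01[OF s]] lam[of s] in01[OF s] by (simp add: \<rho>_def)
    also have "\<dots> = (R a)\<^sup>2 * (1 - r * (L s * R s)) / (r * (L s * R a)\<^sup>2)"
      using s eq by (simp add: green_def power2_eq_square)
    also have "\<dots> = (1 - r * (L s * R s)) / (r * (L s)\<^sup>2)"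
      using p(3) by (simp add: power_mult_distrib)
    finally show ?thesis using p r(1) by (simp add: field_simps power2_eq_square)
  qed
  have Z: "((\<lambda>s. R s / L s) has_real_derivative - 1 / (L s)\<^sup>2) (at s)" if s: "s \<in> {t..a}" for s
  proof -
    have nz: "L s \<noteq> 0" using solutions_pos[OF a r in01[OF s]] by simp
    have "((\<lambda>s. R s / L s) has_real_derivative (deriv R s * L s - R s * deriv L s) / (L s * L s)) (at s)"
      by (rule DERIV_divide[OF has_derivative(2)[OF in01[OF s]] has_derivative(1)[OF in01[OF s]] nz])
    moreover have "deriv R s * L s - R s * deriv L s = -1"
      using wronskian[OF in01[OF s]] by (simp add: algebra_simps)
    ultimately show ?thesis by (simp add: power2_eq_square)
  qed
  have tin: "t \<in> {t..a}" using t by auto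
  have p: "L t > 0" "R t > 0" "R a > 0" using solutions_pos[OF a r in01[OF tin]] solutions_pos[OF a r, of a] a by auto
  have E: "exp (r * (a - t)) + r * integral {t..a} (\<lambda>s. \<rho> s * exp (r * (s - t))) = R t / L t"
    using Z \<rho> t p(3) eq by (intro inversion_left[where Z' = "\<lambda>s. - 1 / (L s)\<^sup>2"]) auto
  have "r * (R t / L t + \<rho> t) / (R t / L t)\<^sup>2 = 1 / (R t)\<^sup>2"
    using p unfolding distrib_left \<rho>[OF tin] by (simp add: power_divide)
  then have "R_formula a r lam (unperturbed_eigenvalue q a w0) t = (1 / (R t)\<^sup>2) powr (- 1 / 2)"
    unfolding R_formula_def \<rho>_def[symmetric] E by simp
  then show ?thesis using inverse_square_powr[OF p(2)] by simp
qed

text \<open>The same computation to the right of \<open>a\<close>, for \<open>Z = L / R\<close> with \<open>Z' = 1 / R\<^sup>2\<close>.\<close>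

lemma L_reconstruction:
  assumes a: "0 < a" "a < 1" and r: "0 < r" "ereal r < r_bound a L R" and "w0 > 0"
    and eq: "L a = R a" and t: "t \<in> {a..<1}"
    and lam: "\<And>t. t \<in> {0..1} \<Longrightarrow> lam t = first_eigenvalue q a w0 r t"
  shows "L_formula a r lam (unperturbed_eigenvalue q a w0) t = L t"
proof -
  define \<rho> where "\<rho> s = lam s / (unperturbed_eigenvalue q a w0 - lam s)" for s
  have in01: "s \<in> {0<..<1}" if "s \<in> {a..t}" for s using that t a by auto
  have \<rho>: "r * \<rho> s = 1 / (R s)\<^sup>2 - r * (L s / R s)" if s: "s \<in> {a..t}" for s
  proof -
    have p: "L s > 0" "R s > 0" "R a > 0" using solutions_pos[OF a r in01[OF s]] solutions_pos[OF a r, of a] a by auto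
    have "\<rho> s = G a a * (1 - r * G s s) / (r * (G a s)\<^sup>2)"
      using eigenvalue_quotient[OF a r \<open>w0 > 0\<close> in01[OF s]] lam[of s] in01[OF s] by (simp add: \<rho>_def)
    also have "\<dots> = (R a)\<^sup>2 * (1 - r * (L s * R s)) / (r * (R a * R s)\<^sup>2)"
      using s eq by (simp add: green_def power2_eq_square)
    also have "\<dots> = (1 - r * (L s * R s)) / (r * (R s)\<^sup>2)"
      using p(3) by (simp add: power_mult_distrib)
    finally show ?thesis using p r(1) by (simp add: field_simps power2_eq_square)
  qed
  have Z: "((\<lambda>s. L s / R s) has_real_derivative 1 / (R s)\<^sup>2) (at s)" if s: "s \<in> {a..t}" for s
  proof -
    have nz: "R s \<noteq> 0" using solutions_pos[OF a r in01[OF s]] by simp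
    have "((\<lambda>s. L s / R s) has_real_derivative (deriv L s * R s - L s * deriv R s) / (R s * R s)) (at s)"
      by (rule DERIV_divide[OF has_derivative(1)[OF in01[OF s]] has_derivative(2)[OF in01[OF s]] nz])
    moreover have "deriv L s * R s - L s * deriv R s = 1"
      using wronskian[OF in01[OF s]] by (simp add: algebra_simps)
    ultimately show ?thesis by (simp add: power2_eq_square)
  qed
  have tin: "t \<in> {a..t}" using t by auto
  have p: "L t > 0" "R t > 0" "R a > 0" using solutions_pos[OF a r in01[OF tin]] solutions_pos[OF a r, of a] a by auto
  have E: "exp (r * (t - a)) + r * integral {a..t} (\<lambda>s. \<rho> s * exp (r * (t - s))) = L t / R t"
    using Z \<rho> t p(3) eq by (intro inversion_right[where Z' = "\<lambda>s. 1 / (R s)\<^sup>2"]) auto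
  have "r * (L t / R t + \<rho> t) / (L t / R t)\<^sup>2 = 1 / (L t)\<^sup>2"
    using p unfolding distrib_left \<rho>[OF tin] by (simp add: power_divide)
  then have "L_formula a r lam (unperturbed_eigenvalue q a w0) t = (1 / (L t)\<^sup>2) powr (- 1 / 2)"
    unfolding L_formula_def \<rho>_def[symmetric] E by simp
  then show ?thesis using inverse_square_powr[OF p(1)] by simp
qed

end

lemma regular_solution_scale:
  assumes "delta_solution q {} \<kappa> y"
  shows "delta_solution q {} \<kappa> (\<lambda>x. c * y x)"
proof -
  note sol = delta_solution_imp_solves_on[OF assms, of 0 1, simplified]
  have "solves_on q {0<..<1} (\<lambda>x. c * y x)"
    by (rule solves_on_of_combination[OF sol(1) sol(1), of _ c 0]) simp
  moreover have "abs_cont_on {0..1} (\<lambda>x. c * y x + 0 * y x)"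
    using assms by (intro abs_cont_on_linear_combination) (auto simp: delta_solution_iff)
  moreover have "(\<lambda>x. c * y x) differentiable (at_right 0)" "(\<lambda>x. c * y x) differentiable (at_left 1)"
    using sol(2,3) by (auto intro: differentiable_mult differentiable_const)
  ultimately show ?thesis
    unfolding delta_solution_iff solves_on_def by auto
qed

lemma fundamental_pair_scale:
  assumes fp: "fundamental_pair q L R" and "c > 0"
  shows "fundamental_pair q (\<lambda>x. c * L x) (\<lambda>x. R x / c)"
proof -
  interpret wronskian_pair q L R by standard (rule fp)
  have dL: "deriv01 (\<lambda>x. c * L x) x = c * deriv01 L x" if "x \<in> {0..1}" for x
    using that by (intro deriv01_eq DERIV_cmult has_derivative01)
  have dR: "deriv01 (\<lambda>x. R x / c) x = deriv01 R x / c" if "x \<in> {0..1}" for x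
    using that by (intro deriv01_eq DERIV_cdivide has_derivative01)
  have "delta_solution q {} (\<lambda>_. 0) (\<lambda>x. R x / c)"
    using regular_solution_scale[OF solution(2), of "1 / c"] by simp
  moreover have "\<forall>x\<in>{0..1}. c * L x * (deriv01 R x / c) - c * deriv01 L x * (R x / c) = -1"
    using wronskian01 \<open>c > 0\<close> by simp
  moreover have "c * deriv01 L 0 > 0" "deriv01 R 1 / c < 0"
    using boundary \<open>c > 0\<close> by (auto simp: divide_neg_pos)
  ultimately show ?thesis
    unfolding fundamental_pair_def
    using regular_solution_scale[OF solution(1)] boundary dL dR by simp
qed

lemma r_bound_scale:
  assumes "c > 0" "L a \<noteq> 0" "R a \<noteq> 0"
  shows "r_bound a (\<lambda>x. c * L x) (\<lambda>x. R x / c) = r_bound a L R"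
proof -
  have "(R t / c - R a / c / (c * L a) * (c * L t)) * (c * L t) = (R t - R a / L a * L t) * L t"
    "(c * L t - c * L a / (R a / c) * (R t / c)) * (R t / c) = (L t - L a / R a * R t) * R t" for t
    using assms by (simp_all add: field_simps)
  then show ?thesis unfolding r_bound_def by (simp only:)
qed

text \<open>The spectral data only depend on the products \<open>G(x,s)\<close>, which do not change under the scaling
  \<open>(c L, R / c)\<close>; so one may pass to the representative with equal values at \<open>a\<close>.\<close>

lemma normalized_reconstruction:
  fixes q L R lam a w0 r
  assumes fp: "fundamental_pair q L R" and a: "0 < a" "a < 1" and "w0 > 0"
    and r: "0 < r" "ereal r < r_bound a L R"
    and lam: "\<And>t. t \<in> {0..1} \<Longrightarrow> lam t = first_eigenvalue q a w0 r t"
  defines "lam1 \<equiv> unperturbed_eigenvalue q a w0"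
  shows "\<exists>c>0. fundamental_pair q (\<lambda>t. c * L t) (\<lambda>t. R t / c) \<and> c * L a = R a / c \<and>
    (\<forall>t\<in>{0<..<1}. 0 < c * L t \<and> 0 < R t / c) \<and>
    (\<forall>t\<in>{0<..a}. R t / c = R_formula a r lam lam1 t) \<and>
    (\<forall>t\<in>{a..<1}. c * L t = L_formula a r lam lam1 t) \<and> lam 0 = lam1 \<and> lam 1 = lam1"
proof -
  interpret wronskian_pair q L R by standard (rule fp)
  have pa: "L a > 0" "R a > 0" using solutions_pos[OF a r, of a] a by auto
  \<comment> \<open>The scaling that makes the two functions agree at \<open>a\<close>.\<close>
  define c where "c = sqrt (R a / L a)"
  have "c > 0" using pa by (simp add: c_def)
  have "c\<^sup>2 = R a / L a" using pa by (simp add: c_def)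
  then have eq: "c * L a = R a / c" using \<open>c > 0\<close> pa by (simp add: field_simps power2_eq_square)
  have fp': "fundamental_pair q (\<lambda>t. c * L t) (\<lambda>t. R t / c)"
    by (rule fundamental_pair_scale[OF fp \<open>c > 0\<close>])
  interpret n: wronskian_pair q "\<lambda>t. c * L t" "\<lambda>t. R t / c" by standard (rule fp')
  have r': "ereal r < r_bound a (\<lambda>t. c * L t) (\<lambda>t. R t / c)"
    using r(2) pa \<open>c > 0\<close> by (simp add: r_bound_scale)
  have "R t / c = R_formula a r lam lam1 t" if "t \<in> {0<..a}" for t
    unfolding lam1_def using n.R_reconstruction[OF a r(1) r' \<open>w0 > 0\<close> eq that lam] by simp
  moreover have "c * L t = L_formula a r lam lam1 t" if "t \<in> {a..<1}" for t
    unfolding lam1_def using n.L_reconstruction[OF a r(1) r' \<open>w0 > 0\<close> eq that lam] by simp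
  moreover have "lam 0 = lam1" "lam 1 = lam1"
    using lam[of 0] lam[of 1] first_eigenvalue_ends[OF a r \<open>w0 > 0\<close>] by (auto simp: lam1_def)
  moreover have "0 < c * L t \<and> 0 < R t / c" if "t \<in> {0<..<1}" for t
    using solutions_pos[OF a r that] \<open>c > 0\<close> by auto
  ultimately show ?thesis using \<open>c > 0\<close> fp' eq by blast
qed

lemma potential_determined_by_solution:
  assumes y: "solves_on q {u<..<v} y" and y2: "solves_on q2 {u<..<v} y2"
    and eq: "\<And>x. x \<in> {u<..<v} \<Longrightarrow> y2 x = y x" and nz: "\<And>x. x \<in> {u<..<v} \<Longrightarrow> y x \<noteq> 0"
  shows "AE x in lebesgue. x \<in> {u<..<v} \<longrightarrow> q2 x = q x"
proof -
  have ev: "\<forall>\<^sub>F t in nhds x. t \<in> {u<..<v}" if "x \<in> {u<..<v}" for x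
    using that by (intro eventually_nhds_in_open) auto
  have deq: "deriv y2 x = deriv y x" if "x \<in> {u<..<v}" for x
    using ev[OF that] eq by (intro deriv_cong_ev) (auto elim: eventually_mono)
  from solves_onD(3)[OF y] solves_onD(3)[OF y2] show ?thesis
  proof eventually_elim
    case (elim x)
    show ?case
    proof
      assume x: "x \<in> {u<..<v}"
      have "(deriv y2 has_real_derivative q2 x * y2 x) (at x)" using elim x by blast
      then have "(deriv y has_real_derivative q2 x * y2 x) (at x)"
        by (rule has_field_derivative_transform_within_open[where S = "{u<..<v}"]) (use x deq in auto)
      then have "q2 x * y2 x = q x * y x" using elim x DERIV_unique by blast
      then show "q2 x = q x" using eq[OF x] nz[OF x] by simp
    qed
  qed
qed

theorem theorem2p5:
  fixes q L R lam :: "real \<Rightarrow> real" and a w0 r lam1 :: real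
  assumes "q absolutely_integrable_on {0..1}"
    and "w0 > 0" and "0 < a" and "a < 1"
    and "left_definite q"
    and "fundamental_pair q L R"
    and "0 < r" and "ereal r < r_bound a L R"
    and "\<And>t. t \<in> {0..1} \<Longrightarrow> lam t = first_eigenvalue q a w0 r t"
    and "lam1 = unperturbed_eigenvalue q a w0"
  shows "(lam1 = lam 0 \<and> lam1 = lam 1) \<and>
    (\<forall>q2 L2 R2. q2 absolutely_integrable_on {0..1} \<and> left_definite q2 \<and>
        fundamental_pair q2 L2 R2 \<and> ereal r < r_bound a L2 R2 \<and>
        (\<forall>t\<in>{0..1}. first_eigenvalue q2 a w0 r t = lam t)
        \<longrightarrow> (AE x in lebesgue. x \<in> {0..1} \<longrightarrow> q2 x = q x)) \<and>
    (\<exists>Ln Rn. (\<exists>c>0. Ln = (\<lambda>t. c * L t) \<and> Rn = (\<lambda>t. R t / c)) \<and>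
        fundamental_pair q Ln Rn \<and> Ln a = Rn a \<and>
        (\<forall>t\<in>{0<..a}. Rn t = R_formula a r lam lam1 t) \<and>
        (\<forall>t\<in>{a..<1}. Ln t = L_formula a r lam lam1 t) \<and>
        (AE x in lebesgue. (x \<in> {0<..a} \<longrightarrow> q x = deriv (deriv Rn) x / Rn x) \<and>
                           (x \<in> {a..<1} \<longrightarrow> q x = deriv (deriv Ln) x / Ln x)))"
proof -
  obtain c where c: "c > 0" "fundamental_pair q (\<lambda>t. c * L t) (\<lambda>t. R t / c)" "c * L a = R a / c"
    "\<forall>t\<in>{0<..<1}. 0 < c * L t \<and> 0 < R t / c"
    "\<forall>t\<in>{0<..a}. R t / c = R_formula a r lam lam1 t"
    "\<forall>t\<in>{a..<1}. c * L t = L_formula a r lam lam1 t"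
    "lam 0 = lam1" "lam 1 = lam1"
    using normalized_reconstruction[OF assms(6,3,4,2,7,8,9), folded assms(10)] by blast
  define Ln Rn where "Ln = (\<lambda>t. c * L t)" and "Rn = (\<lambda>t. R t / c)"
  interpret n: wronskian_pair q Ln Rn by standard (simp add: Ln_def Rn_def c(2))
  have posn: "Ln x > 0" "Rn x > 0" if "x \<in> {0<..<1}" for x
    using c(4) that by (auto simp: Ln_def Rn_def)
  have unique: "AE x in lebesgue. x \<in> {0..1} \<longrightarrow> q2 x = q x"
    if q2: "fundamental_pair q2 L2 R2" "ereal r < r_bound a L2 R2"
      "\<forall>t\<in>{0..1}. first_eigenvalue q2 a w0 r t = lam t" for q2 L2 R2
  proof -
    define mu1 where "mu1 = unperturbed_eigenvalue q2 a w0"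
    have "\<And>t. t \<in> {0..1} \<Longrightarrow> lam t = first_eigenvalue q2 a w0 r t" using q2(3) by simp
    note reconstruction = normalized_reconstruction[OF q2(1) assms(3,4,2,7) q2(2) this, folded mu1_def]
    obtain d where d: "fundamental_pair q2 (\<lambda>t. d * L2 t) (\<lambda>t. R2 t / d)"
      "\<forall>t\<in>{0<..a}. R2 t / d = R_formula a r lam mu1 t"
      "\<forall>t\<in>{a..<1}. d * L2 t = L_formula a r lam mu1 t" "lam 0 = mu1"
      using reconstruction by blast
    \<comment> \<open>The unperturbed eigenvalue is part of the data, as the value at \<open>t = 0\<close>.\<close>
    have mu1: "mu1 = lam1" using d(4) c(7) by simp
    interpret n2: wronskian_pair q2 "\<lambda>t. d * L2 t" "\<lambda>t. R2 t / d" by standard (rule d(1))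
    have sub: "{0<..<a} \<subseteq> {0<..<1}" "{a<..<1} \<subseteq> {0<..<1}" using assms(3,4) by auto
    have "AE x in lebesgue. x \<in> {0<..<a} \<longrightarrow> q2 x = q x"
    proof (rule potential_determined_by_solution)
      show "solves_on q {0<..<a} Rn" "solves_on q2 {0<..<a} (\<lambda>t. R2 t / d)"
        by (rule solves_on_subset[OF n.solves(2) sub(1)] solves_on_subset[OF n2.solves(2) sub(1)])+
      show "R2 x / d = Rn x" if "x \<in> {0<..<a}" for x
        using that c(5) d(2) by (simp add: Rn_def mu1)
      show "Rn x \<noteq> 0" if "x \<in> {0<..<a}" for x using posn(2)[of x] that assms(4) by auto
    qed
    moreover have "AE x in lebesgue. x \<in> {a<..<1} \<longrightarrow> q2 x = q x"
    proof (rule potential_determined_by_solution)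
      show "solves_on q {a<..<1} Ln" "solves_on q2 {a<..<1} (\<lambda>t. d * L2 t)"
        by (rule solves_on_subset[OF n.solves(1) sub(2)] solves_on_subset[OF n2.solves(1) sub(2)])+
      show "d * L2 x = Ln x" if "x \<in> {a<..<1}" for x
        using that c(6) d(3) by (simp add: Ln_def mu1)
      show "Ln x \<noteq> 0" if "x \<in> {a<..<1}" for x using posn(1)[of x] that assms(3) by auto
    qed
    moreover have "AE x in lebesgue. x \<notin> {0, a, 1}"
      by (rule AE_not_in) (simp add: negligible_iff_null_sets[symmetric] negligible_finite)
    ultimately show ?thesis
    proof eventually_elim
      case (elim x)
      then show ?case by (cases "x < a") auto
    qed
  qed
  have pot: "AE x in lebesgue. (x \<in> {0<..a} \<longrightarrow> q x = deriv (deriv Rn) x / Rn x) \<and>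
      (x \<in> {a..<1} \<longrightarrow> q x = deriv (deriv Ln) x / Ln x)"
    using solves_onD(3)[OF n.solves(1)] solves_onD(3)[OF n.solves(2)]
  proof eventually_elim
    case (elim x)
    have "q x = deriv (deriv Rn) x / Rn x \<and> q x = deriv (deriv Ln) x / Ln x" if x: "x \<in> {0<..<1}"
    proof -
      have "deriv (deriv Ln) x = q x * Ln x" "deriv (deriv Rn) x = q x * Rn x"
        using elim x by (blast intro: DERIV_imp_deriv)+
      then show ?thesis using posn[OF x] by simp
    qed
    then show ?case using assms(3,4) by auto
  qed
  have "\<exists>c>0. Ln = (\<lambda>t. c * L t) \<and> Rn = (\<lambda>t. R t / c)" using c(1) by (auto simp: Ln_def Rn_def)
  moreover have "Ln a = Rn a" "\<forall>t\<in>{0<..a}. Rn t = R_formula a r lam lam1 t"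
    "\<forall>t\<in>{a..<1}. Ln t = L_formula a r lam lam1 t"
    using c(3,5,6) by (auto simp: Ln_def Rn_def)
  ultimately have rec: "\<exists>Ln Rn. (\<exists>c>0. Ln = (\<lambda>t. c * L t) \<and> Rn = (\<lambda>t. R t / c)) \<and>
        fundamental_pair q Ln Rn \<and> Ln a = Rn a \<and>
        (\<forall>t\<in>{0<..a}. Rn t = R_formula a r lam lam1 t) \<and>
        (\<forall>t\<in>{a..<1}. Ln t = L_formula a r lam lam1 t) \<and>
        (AE x in lebesgue. (x \<in> {0<..a} \<longrightarrow> q x = deriv (deriv Rn) x / Rn x) \<and>
                           (x \<in> {a..<1} \<longrightarrow> q x = deriv (deriv Ln) x / Ln x))"
    using pot n.pair by (intro exI[of _ Ln] exI[of _ Rn] conjI)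
  show ?thesis
  proof (intro conjI)
    show "\<forall>q2 L2 R2. q2 absolutely_integrable_on {0..1} \<and> left_definite q2 \<and>
        fundamental_pair q2 L2 R2 \<and> ereal r < r_bound a L2 R2 \<and>
        (\<forall>t\<in>{0..1}. first_eigenvalue q2 a w0 r t = lam t)
        \<longrightarrow> (AE x in lebesgue. x \<in> {0..1} \<longrightarrow> q2 x = q x)"
      by (intro allI impI, elim conjE) (rule unique)
  qed (use c(7,8) rec in simp_all)
qed

end
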